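(* Let $\mathfrak g$ be a simple finite-dimensional real Lie algebra and $h\in\mathfrak g$ an Euler element. Then: (a) If $x\in\mathfrak g$ is an Euler element such that $(h,x)$ is orthogonal, then (i) $h$ and $x$ are symmetric, (ii) the Lie subalgebra of $\mathfrak g$ generated by $h$ and $x$ is isomorphic to $\mathfrak{sl}_2(\mathbb R)$, and (iii) $\sigma_x(h)=-h$, so that $(x,h)$ is also orthogonal. (b) There exists an Euler element $x$ such that $(h,x)$ is orthogonal if and only if $h$ is symmetric.
   Context: An Euler element of a finite-dimensional real Lie algebra $\mathfrak g$ is a non-zero $x\in\mathfrak g$ such that $\operatorname{ad}x$ is diagonalizable with $\operatorname{Spec}(\operatorname{ad}x)\subseteq\{-1,0,1\}$; then $\mathfrak g=\mathfrak g_1(x)\oplus\mathfrak g_0(x)\oplus\mathfrak g_{-1}(x)$ with $\mathfrak g_\nu(x)=\ker(\operatorname{ad}x-\nu\,\mathrm{id})$, and $\sigma_x$ denotes the involutive automorphism of $\mathfrak g$ with $\sigma_x(y)=(-1)^jy$ for $y\in\mathfrak g_j(x)$. An Euler element $x$ is symmetric if $-x\in\operatorname{Inn}(\mathfrak g)x$, where $\operatorname{Inn}(\mathfrak g)=\langle e^{\operatorname{ad}\mathfrak g}\rangle$. A pair $(h,x)$ of Euler elements is called orthogonal if $\sigma_h(x)=-x$. *)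

theory Defs
  imports "HOL-Analysis.Analysis"
begin

text \<open>A finite-dimensional real Lie algebra is modelled as a bracket on a
  type of class euclidean_space (a finite-dimensional real inner product space;
  the inner product plays no role).\<close>

definition lie_algebra :: "('a::real_vector \<Rightarrow> 'a \<Rightarrow> 'a) \<Rightarrow> bool" where
  "lie_algebra br \<longleftrightarrow> bilinear br \<and> (\<forall>x. br x x = 0) \<and>
     (\<forall>x y z. br x (br y z) + br y (br z x) + br z (br x y) = 0)"

definition lie_ideal :: "('a::real_vector \<Rightarrow> 'a \<Rightarrow> 'a) \<Rightarrow> 'a set \<Rightarrow> bool" where
  "lie_ideal br I \<longleftrightarrow> subspace I \<and> (\<forall>x\<in>I. \<forall>y. br y x \<in> I)"

definition simple_lie :: "('a::real_vector \<Rightarrow> 'a \<Rightarrow> 'a) \<Rightarrow> bool" where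
  "simple_lie br \<longleftrightarrow> lie_algebra br \<and> (\<exists>x y. br x y \<noteq> 0) \<and>
     (\<forall>I. lie_ideal br I \<longrightarrow> I = {0} \<or> I = UNIV)"

definition eig :: "('a::real_vector \<Rightarrow> 'a \<Rightarrow> 'a) \<Rightarrow> 'a \<Rightarrow> real \<Rightarrow> 'a set" where
  "eig br x \<nu> = {y. br x y = \<nu> *\<^sub>R y}"

text \<open>Euler element: nonzero, ad x diagonalizable with spectrum in {-1,0,1},
  i.e. g = g_1(x) + g_0(x) + g_{-1}(x).\<close>
definition euler :: "('a::real_vector \<Rightarrow> 'a \<Rightarrow> 'a) \<Rightarrow> 'a \<Rightarrow> bool" where
  "euler br x \<longleftrightarrow> x \<noteq> 0 \<and>
     (\<forall>y. \<exists>a b c. a \<in> eig br x 1 \<and> b \<in> eig br x 0 \<and> c \<in> eig br x (-1) \<and> y = a + b + c)"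

definition sigma :: "('a::real_vector \<Rightarrow> 'a \<Rightarrow> 'a) \<Rightarrow> 'a \<Rightarrow> 'a \<Rightarrow> 'a" where
  "sigma br x y = (THE z. \<exists>a b c. a \<in> eig br x 1 \<and> b \<in> eig br x 0 \<and> c \<in> eig br x (-1)
        \<and> y = a + b + c \<and> z = b - a - c)"

definition exp_ad :: "('a::real_normed_vector \<Rightarrow> 'a \<Rightarrow> 'a) \<Rightarrow> 'a \<Rightarrow> 'a \<Rightarrow> 'a" where
  "exp_ad br y = (\<lambda>z. \<Sum>n. ((br y) ^^ n) z /\<^sub>R fact n)"

inductive_set Inn :: "('a::real_normed_vector \<Rightarrow> 'a \<Rightarrow> 'a) \<Rightarrow> ('a \<Rightarrow> 'a) set"
  for br where
  Inn_id: "id \<in> Inn br"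
| Inn_exp: "f \<in> Inn br \<Longrightarrow> exp_ad br y \<circ> f \<in> Inn br"
| Inn_inv: "f \<in> Inn br \<Longrightarrow> inv (exp_ad br y) \<circ> f \<in> Inn br"

definition symmetric_euler :: "('a::real_normed_vector \<Rightarrow> 'a \<Rightarrow> 'a) \<Rightarrow> 'a \<Rightarrow> bool" where
  "symmetric_euler br x \<longleftrightarrow> euler br x \<and> (\<exists>\<phi>\<in>Inn br. \<phi> x = - x)"

definition orthogonal_pair :: "('a::real_vector \<Rightarrow> 'a \<Rightarrow> 'a) \<Rightarrow> 'a \<Rightarrow> 'a \<Rightarrow> bool" where
  "orthogonal_pair br h x \<longleftrightarrow> euler br h \<and> euler br x \<and> sigma br h x = - x"

definition lie_subalgebra :: "('a::real_vector \<Rightarrow> 'a \<Rightarrow> 'a) \<Rightarrow> 'a set \<Rightarrow> bool" where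
  "lie_subalgebra br S \<longleftrightarrow> subspace S \<and> (\<forall>x\<in>S. \<forall>y\<in>S. br x y \<in> S)"

definition gen_subalgebra :: "('a::real_vector \<Rightarrow> 'a \<Rightarrow> 'a) \<Rightarrow> 'a set \<Rightarrow> 'a set" where
  "gen_subalgebra br A = \<Inter>{S. lie_subalgebra br S \<and> A \<subseteq> S}"

definition sl2 :: "(real^2^2) set" where
  "sl2 = {A. trace A = 0}"

definition iso_to_sl2 :: "('a::real_vector \<Rightarrow> 'a \<Rightarrow> 'a) \<Rightarrow> 'a set \<Rightarrow> bool" where
  "iso_to_sl2 br S \<longleftrightarrow> (\<exists>f :: 'a \<Rightarrow> real^2^2. linear f \<and> bij_betw f S sl2 \<and>
      (\<forall>u\<in>S. \<forall>v\<in>S. f (br u v) = f u ** f v - f v ** f u))"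

end

theory Submission
  imports Defs "HOL-Complex_Analysis.Complex_Analysis"
begin

text \<open>Write \<open>h = e + h\<^sub>0 + f\<close> for the grading by \<open>x\<close>. Orthogonality \<open>[h,[h,x]] = x\<close> makes \<open>e, f, x\<close> span a copy
  of \<open>\<ss>\<ll>\<^sub>2\<close> commuting with \<open>h\<^sub>0\<close>, and the cubic equation for \<open>ad h\<close> forces \<open>h\<^sub>0\<close> to centralize
  \<open>\<gg>\<^sub>\<plusminus>\<^sub>1(x)\<close>, hence to vanish. So \<open>[x,[x,h]] = h\<close>, and \<open>h, x, [h,x]\<close> span \<open>\<ss>\<ll>\<^sub>2\<close>; the rotations
  \<open>exp (t ad [h,x])\<close> move \<open>h\<close> to \<open>-h\<close> and \<open>x\<close> to \<open>-x\<close>.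

  Conversely, let \<open>\<phi> h = -h\<close> with \<open>\<phi>\<close> inner. Moving \<open>\<phi>\<close> along an analytic path of automorphisms starting
  at the identity yields a generic automorphism \<open>g\<close> for which the parabolic \<open>g (\<gg>\<^sub>0 + \<gg>\<^sub>1)\<close> is opposite to
  both parabolics \<open>\<gg>\<^sub>0 + \<gg>\<^sub>\<plusminus>\<^sub>1\<close>. It contains \<open>h + f\<close> for some \<open>f \<in> \<gg>\<^sub>-\<^sub>1\<close> for which
  \<open>(ad f)\<^sup>2 : \<gg>\<^sub>1 \<rightarrow> \<gg>\<^sub>-\<^sub>1\<close> is bijective. Such an \<open>f\<close> completes to an \<open>\<ss>\<ll>\<^sub>2\<close>-triple
  \<open>(y, 2h, f)\<close>, and \<open>x = (y + f)/2\<close> is conjugate to \<open>\<plusminus>h\<close> by a rotation.\<close>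

section \<open>Gradings by Euler elements\<close>

lemma scaleR_half_add_half: "(1/2) *\<^sub>R v + (1/2) *\<^sub>R v = (v :: 'a::real_vector)"
  by (simp flip: scaleR_add_left)

locale lie_alg =
  fixes br :: "'a::real_vector \<Rightarrow> 'a \<Rightarrow> 'a"
  assumes lie: "lie_algebra br"
begin

lemma bilin: "bilinear br"
  using lie by (simp add: lie_algebra_def)

lemmas br_simps =
  bilinear_ladd[OF bilin] bilinear_radd[OF bilin] bilinear_lmul[OF bilin] bilinear_rmul[OF bilin]
  bilinear_lneg[OF bilin] bilinear_rneg[OF bilin] bilinear_lzero[OF bilin] bilinear_rzero[OF bilin]
  bilinear_lsub[OF bilin] bilinear_rsub[OF bilin]

lemma linear_br: "linear (br x)"
  using bilin by (simp add: bilinear_def)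

lemma br_self: "br x x = 0"
  using lie by (simp add: lie_algebra_def)

lemma br_anti: "br y x = - br x y"
proof -
  have "br (x + y) (x + y) = 0" by (rule br_self)
  then have "br x y + br y x = 0" by (simp add: br_simps br_self[of x] br_self[of y] add.commute)
  then show ?thesis by (metis eq_neg_iff_add_eq_0 add.commute)
qed

lemma jacobi: "br x (br y z) = br (br x y) z + br y (br x z)"
proof -
  have "br x (br y z) + br y (br z x) + br z (br x y) = 0"
    using lie by (simp add: lie_algebra_def)
  moreover have "br y (br z x) = - br y (br x z)"
    by (simp add: br_anti[of z x] br_simps)
  moreover have "br z (br x y) = - br (br x y) z"
    by (rule br_anti)
  ultimately show ?thesis by (simp add: algebra_simps)
qed

lemma euler_cubic:
  assumes "euler br x"
  shows "br x (br x (br x y)) = br x y"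
proof -
  obtain a b c where "a \<in> eig br x 1" "b \<in> eig br x 0" "c \<in> eig br x (-1)" "y = a + b + c"
    using assms unfolding euler_def by blast
  then show ?thesis by (simp add: eig_def br_simps)
qed

text \<open>For \<open>A = ad x\<close> the three operators are the Lagrange interpolation
  projections \<open>(A^2 + A)/2\<close>, \<open>1 - A^2\<close> and \<open>(A^2 - A)/2\<close> at
  the nodes 1, 0, -1.\<close>

lemma eig_parts:
  assumes cubic: "\<And>y. br x (br x (br x y)) = br x y"
  shows "(1/2) *\<^sub>R (br x (br x y) + br x y) \<in> eig br x 1"
    and "y - br x (br x y) \<in> eig br x 0"
    and "(1/2) *\<^sub>R (br x (br x y) - br x y) \<in> eig br x (-1)"
  by (simp_all add: eig_def br_simps cubic algebra_simps)

lemma sum_parts: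
  "y = (1/2) *\<^sub>R (br x (br x y) + br x y) + (y - br x (br x y)) + (1/2) *\<^sub>R (br x (br x y) - br x y)"
  by (simp add: scaleR_add_right scaleR_diff_right scaleR_half_add_half algebra_simps)

text \<open>\<open>X^3 - X\<close> has the three simple roots 1, 0, -1, so it annihilates
  \<open>ad x\<close> exactly when \<open>ad x\<close> is diagonalizable with these eigenvalues. In
  this form the property passes to \<open>- x\<close> and to images under automorphisms by direct
  computation.\<close>

lemma euler_iff:
  "euler br x \<longleftrightarrow> x \<noteq> 0 \<and> (\<forall>y. br x (br x (br x y)) = br x y)"
proof
  assume "x \<noteq> 0 \<and> (\<forall>y. br x (br x (br x y)) = br x y)"
  then show "euler br x"
    unfolding euler_def using eig_parts sum_parts by blast
qed (use euler_cubic in \<open>auto simp: euler_def\<close>)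

lemma eig_sum_zero:
  assumes "a \<in> eig br x 1" "b \<in> eig br x 0" "c \<in> eig br x (-1)" "a + b + c = 0"
  shows "a = 0" "b = 0" "c = 0"
proof -
  have "br x (a + b + c) = 0" "br x (br x (a + b + c)) = 0"
    using assms(4) by (simp_all add: br_simps)
  moreover have "br x (a + b + c) = a - c" "br x (br x (a + b + c)) = a + c"
    using assms(1-3) by (simp_all add: eig_def br_simps)
  ultimately have "a = c" and "a + c = 0" by simp_all
  then have "2 *\<^sub>R a = 0" by (simp only: scaleR_2)
  then show "a = 0" by simp
  then show "c = 0" using \<open>a = c\<close> by simp
  then show "b = 0" using \<open>a = 0\<close> assms(4) by simp
qed

lemma eig_unique:
  assumes "a \<in> eig br x 1" "b \<in> eig br x 0" "c \<in> eig br x (-1)"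
    and "a' \<in> eig br x 1" "b' \<in> eig br x 0" "c' \<in> eig br x (-1)"
    and "a + b + c = a' + b' + c'"
  shows "a = a'" "b = b'" "c = c'"
proof -
  have "a - a' \<in> eig br x 1" "b - b' \<in> eig br x 0" "c - c' \<in> eig br x (-1)"
    using assms(1-6) by (simp_all add: eig_def br_simps algebra_simps)
  moreover have "(a - a') + (b - b') + (c - c') = 0"
    using assms(7) by (simp add: algebra_simps)
  ultimately show "a = a'" "b = b'" "c = c'"
    using eig_sum_zero[of "a - a'" x "b - b'" "c - c'"] by simp_all
qed

text \<open>The square of \<open>ad x\<close> acts as 1, 0, 1 in degrees 1, 0, -1, so
  \<open>1 - 2 (ad x)^2\<close> has the right signs. Uniqueness of the graded components resolves
  the definite description.\<close>

lemma sigma_eq: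
  assumes "euler br x"
  shows "sigma br x y = y - 2 *\<^sub>R br x (br x y)"
proof -
  obtain a b c where abc: "a \<in> eig br x 1" "b \<in> eig br x 0" "c \<in> eig br x (-1)" "y = a + b + c"
    using assms unfolding euler_def by blast
  have "sigma br x y = b - a - c"
    unfolding sigma_def
  proof (rule the_equality)
    show "\<exists>a' b' c'. a' \<in> eig br x 1 \<and> b' \<in> eig br x 0 \<and> c' \<in> eig br x (-1)
        \<and> y = a' + b' + c' \<and> b - a - c = b' - a' - c'"
      using abc by blast
    show "z = b - a - c" if ex: "\<exists>a b c. a \<in> eig br x 1 \<and> b \<in> eig br x 0 \<and> c \<in> eig br x (-1)
        \<and> y = a + b + c \<and> z = b - a - c" for z
    proof -
      obtain a' b' c' where abc': "a' \<in> eig br x 1" "b' \<in> eig br x 0" "c' \<in> eig br x (-1)"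
          "y = a' + b' + c'" "z = b' - a' - c'"
        using ex by blast
      have "a + b + c = a' + b' + c'" using abc(4) abc'(4) by simp
      from eig_unique[OF abc(1-3) abc'(1-3) this] show ?thesis using abc'(5) by simp
    qed
  qed
  also have "\<dots> = y - 2 *\<^sub>R br x (br x y)"
    using abc by (simp add: eig_def br_simps scaleR_2)
  finally show ?thesis .
qed

lemma sigma_neg_iff:
  assumes "euler br x"
  shows "sigma br x y = - y \<longleftrightarrow> br x (br x y) = y"
proof
  assume "sigma br x y = - y"
  then have "2 *\<^sub>R (br x (br x y)) = 2 *\<^sub>R y"
    by (simp add: sigma_eq[OF assms] scaleR_2 algebra_simps)
  then show "br x (br x y) = y" by (simp only: scaleR_cancel_left) simp
qed (simp add: sigma_eq[OF assms] scaleR_2)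

lemma eig_br:
  assumes "u \<in> eig br x \<mu>" "v \<in> eig br x \<nu>"
  shows "br u v \<in> eig br x (\<mu> + \<nu>)"
  using assms jacobi[of x u v] by (simp add: eig_def br_simps scaleR_add_left)

text \<open>Applied with \<open>\<mu>\<close> equal to 2 and -2: brackets within degree 1, or within
  degree -1, vanish.\<close>

lemma euler_eig_zero:
  assumes "euler br x" "v \<in> eig br x \<mu>" "\<mu> ^ 3 \<noteq> \<mu>"
  shows "v = 0"
proof -
  have "br x (br x (br x v)) = br x v" by (rule euler_cubic[OF assms(1)])
  then have "(\<mu> * (\<mu> * \<mu>)) *\<^sub>R v = \<mu> *\<^sub>R v" using assms(2) by (simp add: eig_def br_simps)
  then show ?thesis using assms(3) by (auto simp: power3_eq_cube)
qed

lemma eig_minus: "eig br (- x) \<mu> = eig br x (- \<mu>)"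
proof -
  have "- br x y = \<mu> *\<^sub>R y \<longleftrightarrow> br x y = - (\<mu> *\<^sub>R y)" for y
    by (metis minus_minus)
  then show ?thesis by (simp add: eig_def br_simps)
qed

lemma euler_minus: "euler br x \<Longrightarrow> euler br (- x)"
  by (simp add: euler_iff br_simps)

end

section \<open>Simple Lie algebras and the symmetry of orthogonality\<close>

locale simple_alg = lie_alg +
  assumes simple: "simple_lie br"
begin

lemma ideal_cases: "lie_ideal br I \<Longrightarrow> I = {0} \<or> I = UNIV"
  using simple by (auto simp: simple_lie_def)

lemma center_trivial:
  assumes "\<And>y. br y x = 0"
  shows "x = 0"
proof -
  let ?Z = "{x. \<forall>y. br y x = 0}"
  have "lie_ideal br ?Z"
    by (simp add: lie_ideal_def subspace_def br_simps)
  then have "?Z = {0} \<or> ?Z = UNIV"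
    by (rule ideal_cases)
  moreover obtain u v where "br u v \<noteq> 0"
    using simple by (auto simp only: simple_lie_def)
  then have "v \<notin> ?Z" by blast
  moreover have "x \<in> ?Z" using assms by simp
  ultimately show ?thesis by blast
qed

text \<open>The centralizer of \<open>\<gg>\<^sub>1 + \<gg>\<^sub>-\<^sub>1\<close> is an ideal.\<close>

lemma centralizer_eig_trivial:
  assumes x: "euler br x"
    and d1: "\<And>v. v \<in> eig br x 1 \<Longrightarrow> br d v = 0"
    and d2: "\<And>v. v \<in> eig br x (-1) \<Longrightarrow> br d v = 0"
  shows "d = 0"
proof -
  let ?V = "eig br x 1 \<union> eig br x (-1)"
  let ?K = "{d. \<forall>v\<in>?V. br d v = 0}"
  have "lie_ideal br ?K"
    unfolding lie_ideal_def
  proof (intro conjI ballI allI)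
    show "subspace ?K" by (simp add: subspace_def br_simps)
    fix d y assume d: "d \<in> ?K"
    obtain a b c where abc: "a \<in> eig br x 1" "b \<in> eig br x 0" "c \<in> eig br x (-1)" "y = a + b + c"
      using x unfolding euler_def by blast
    have "br d a = 0" "br d c = 0" using d abc(1,3) by blast+
    then have "br y d = br b d"
      using br_anti[of a d] br_anti[of c d] by (simp add: abc(4) br_simps)
    moreover have "br (br b d) v = 0" if v: "v \<in> ?V" for v
    proof -
      have "br b v \<in> ?V" using v eig_br[OF abc(2), of v 1] eig_br[OF abc(2), of v "-1"] by auto
      then have "br d (br b v) = 0" "br d v = 0" using d v by blast+
      then show ?thesis using jacobi[of b d v] by (simp add: br_simps)
    qed
    ultimately show "br y d \<in> ?K" by simp
  qed
  then have "?K = {0} \<or> ?K = UNIV" by (rule ideal_cases)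
  moreover have "?K \<noteq> UNIV"
  proof
    \<comment> \<open>Now \<open>x\<close> itself lies in \<open>?K\<close>, so \<open>ad x\<close>
      kills degrees 1 and -1 along with degree 0, and \<open>x\<close> would be central.\<close>
    assume "?K = UNIV"
    then have K: "br x v = 0" if "v \<in> ?V" for v using that by blast
    have zero: "br x y = 0" for y
    proof -
      obtain a b c where abc: "a \<in> eig br x 1" "b \<in> eig br x 0" "c \<in> eig br x (-1)" "y = a + b + c"
        using x unfolding euler_def by blast
      have "br x b = 0" using abc(2) by (simp add: eig_def)
      then show ?thesis using K[of a] K[of c] abc by (simp add: br_simps)
    qed
    have "br y x = 0" for y
      using zero[of y] br_anti[of y x] by simp
    then have "x = 0" by (rule center_trivial)
    then show False using x by (simp add: euler_def)
  qed
  moreover have "d \<in> ?K" using d1 d2 by blast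
  ultimately show ?thesis by blast
qed

text \<open>Here \<open>[h, x] = f - e\<close>, and a second bracket with \<open>h\<close> has
  components \<open>- [h0, e]\<close>, \<open>2 [e, f]\<close>, \<open>[h0, f]\<close> in degrees 1,
  0, -1. They are compared with \<open>x\<close>, which has pure degree 0.\<close>

lemma orthogonal_commute:
  assumes h: "euler br h" and x: "euler br x" and ort: "br h (br h x) = x"
    and parts: "h = e + h0 + f" "e \<in> eig br x 1" "h0 \<in> eig br x 0" "f \<in> eig br x (-1)"
  shows "br h0 e = 0" "br h0 f = 0" "2 *\<^sub>R br e f = x"
proof -
  have e: "br x e = e" "br e x = - e" and h0: "br x h0 = 0" "br h0 x = 0"
    and f: "br x f = - f" "br f x = f"
    using parts(2-4) br_anti[of e x] br_anti[of h0 x] br_anti[of f x] by (auto simp: eig_def)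
  have "br h x = f - e" by (simp add: parts(1) br_simps e h0 f)
  then have "x = br (e + h0 + f) (f - e)" using ort by (simp add: parts(1))
  also have "\<dots> = br e f + br h0 f - br h0 e - br f e"
    by (simp add: br_simps br_self)
  also have "\<dots> = (- br h0 e) + 2 *\<^sub>R br e f + br h0 f"
    using br_anti[of f e] by (simp add: scaleR_2)
  finally have eq: "(- br h0 e) + 2 *\<^sub>R br e f + br h0 f = 0 + x + 0" by simp
  have 1: "- br h0 e \<in> eig br x 1" "2 *\<^sub>R br e f \<in> eig br x 0" "br h0 f \<in> eig br x (-1)"
    using eig_br[OF parts(3,2)] eig_br[OF parts(3,4)] eig_br[OF parts(2,4)]
    by (simp_all add: eig_def br_simps)
  have 2: "0 \<in> eig br x 1" "x \<in> eig br x 0" "0 \<in> eig br x (-1)"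
    by (simp_all add: eig_def br_simps br_self)
  show "br h0 e = 0" "br h0 f = 0" "2 *\<^sub>R br e f = x"
    using eig_unique[OF 1 2 eq] by simp_all
qed

text \<open>On the \<open>\<ss>\<ll>\<^sub>2\<close>-module generated by \<open>y\<close>, the operator \<open>ad h\<close> is the sum of the commuting
  operators \<open>ad h\<^sub>0\<close> and \<open>ad (e + f)\<close>; comparing the graded components of
  \<open>(ad h)\<^sup>3 y = ad h y\<close> kills \<open>ad h\<^sub>0 y\<close>.\<close>

lemma orthogonal_centralizes:
  assumes h: "euler br h" and x: "euler br x" and ort: "br h (br h x) = x"
    and parts: "h = e + h0 + f" "e \<in> eig br x 1" "h0 \<in> eig br x 0" "f \<in> eig br x (-1)"
    and y: "y \<in> eig br x 1"
  shows "br h0 y = 0"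
proof -
  note com = orthogonal_commute[OF h x ort parts]
  have he: "br h0 (br e v) = br e (br h0 v)" and hf: "br h0 (br f v) = br f (br h0 v)" for v
    using jacobi[of h0 e v] jacobi[of h0 f v] com by (simp_all add: br_simps)
  have ef: "br e f = (1/2) *\<^sub>R x" by (simp flip: com(3))
  have top: "br e v = 0" if "v \<in> eig br x 1" for v
    using eig_br[OF parts(2) that] euler_eig_zero[OF x, of _ 2] by simp
  have bot: "br f v = 0" if "v \<in> eig br x (-1)" for v
    using eig_br[OF parts(4) that] euler_eig_zero[OF x, of _ "-2"] by simp
  \<comment> \<open>Lowering by \<open>f\<close> runs through \<open>y\<close>, \<open>w\<close>,
    \<open>u\<close> in degrees 1, 0, -1 and then stops; \<open>e\<close> climbs back with a factor
    1/2 at each stage.\<close>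
  define w where "w = br f y"
  define u where "u = br f w"
  have w: "w \<in> eig br x 0" using eig_br[OF parts(4) y] by (simp add: w_def)
  have u: "u \<in> eig br x (-1)" using eig_br[OF parts(4) w] by (simp add: u_def)
  have ew: "br e w = (1/2) *\<^sub>R y"
    using jacobi[of e f y] top[OF y] y by (simp add: w_def ef br_simps eig_def)
  have eu: "br e u = (1/2) *\<^sub>R w"
    using jacobi[of e f w, folded u_def] w by (simp add: ef ew br_simps eig_def w_def[symmetric])
  have fu: "br f u = 0" by (rule bot[OF u])
  have stay: "br h0 v \<in> eig br x \<mu>" if "v \<in> eig br x \<mu>" for v \<mu>
    using eig_br[OF parts(3) that] by simp
  let ?p = "br h0"
  have comp: "br h (br h (br h y)) =
      (?p (?p (?p y)) + (3/2) *\<^sub>R ?p y) + (3 *\<^sub>R ?p (?p w) + w) + 3 *\<^sub>R ?p u"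
  proof -
    have 1: "br h y = ?p y + w"
      by (simp add: parts(1) br_simps top[OF y] w_def)
    have 2: "br h (br h y) = ?p (?p y) + (1/2) *\<^sub>R y + 2 *\<^sub>R ?p w + u"
      unfolding 1 using top[OF y]
      by (simp add: parts(1) br_simps w_def[symmetric] u_def[symmetric] ew he[symmetric]
          hf[symmetric] scaleR_2)
    have 3: "3 *\<^sub>R v = v + 2 *\<^sub>R v" "(3/2) *\<^sub>R v = v + (1/2) *\<^sub>R v" for v :: 'a
      using scaleR_add_left[of 1 2 v] scaleR_add_left[of 1 "1/2" v] by simp_all
    show ?thesis
      unfolding 2 using top[OF y]
      by (simp add: parts(1) br_simps w_def[symmetric] u_def[symmetric] ew eu fu he[symmetric]
          hf[symmetric] algebra_simps 3 scaleR_half_add_half)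
  qed
  have "br h (br h (br h y)) = br h y" by (rule euler_cubic[OF h])
  also have "\<dots> = ?p y + w + 0"
    by (simp add: parts(1) br_simps top[OF y] w_def)
  finally have eq: "(?p (?p (?p y)) + (3/2) *\<^sub>R ?p y) + (3 *\<^sub>R ?p (?p w) + w) + 3 *\<^sub>R ?p u = ?p y + w + 0"
    unfolding comp .
  have mem: "?p (?p (?p y)) + (3/2) *\<^sub>R ?p y \<in> eig br x 1"
      "3 *\<^sub>R ?p (?p w) + w \<in> eig br x 0" "3 *\<^sub>R ?p u \<in> eig br x (-1)"
      "?p y \<in> eig br x 1" "w \<in> eig br x 0" "0 \<in> eig br x (-1)"
    using stay[OF y] stay[OF stay[OF y]] stay[OF stay[OF stay[OF y]]] stay[OF stay[OF w]] w stay[OF u]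
    by (simp_all add: eig_def br_simps)
  have y3: "?p (?p (?p y)) + (3/2) *\<^sub>R ?p y = ?p y" and w2: "3 *\<^sub>R ?p (?p w) + w = w"
    by (rule eig_unique[OF mem eq])+
  \<comment> \<open>Degree 0 kills \<open>?p (?p w)\<close>; raising with \<open>e\<close> kills
    \<open>?p (?p y)\<close>. The degree 1 equation then says that 3/2 times \<open>?p y\<close>
    equals \<open>?p y\<close>.\<close>
  have "?p (?p w) = 0" using w2 by simp
  then have "br e (?p (?p w)) = 0" by (simp add: br_simps)
  then have "?p (?p y) = 0" by (simp add: he[symmetric] ew br_simps)
  then have "(3/2) *\<^sub>R ?p y = 1 *\<^sub>R ?p y" using y3 by (simp add: br_simps)
  then show ?thesis by (simp only: scaleR_cancel_right) simp
qed

lemma orthogonal_sym: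
  assumes h: "euler br h" and x: "euler br x" and ort: "br h (br h x) = x"
  shows "br x (br x h) = h"
proof -
  obtain e h0 f where parts: "e \<in> eig br x 1" "h0 \<in> eig br x 0" "f \<in> eig br x (-1)" "h = e + h0 + f"
    using x unfolding euler_def by blast
  have "br h0 y = 0" if "y \<in> eig br x 1" for y
    by (rule orthogonal_centralizes[OF h x ort parts(4,1,2,3) that])
  moreover have "br h0 y = 0" if "y \<in> eig br x (-1)" for y
  \<comment> \<open>Passing from \<open>x\<close> to \<open>- x\<close> exchanges degrees 1 and -1,
    and with them \<open>e\<close> and \<open>f\<close>.\<close>
  proof (rule orthogonal_centralizes[OF h euler_minus[OF x]])
    show "br h (br h (- x)) = - x" using ort by (simp add: br_simps)
    show "h = f + h0 + e" using parts(4) by (simp add: algebra_simps)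
  qed (use parts that in \<open>simp_all add: eig_minus\<close>)
  ultimately have "h0 = 0" by (rule centralizer_eig_trivial[OF x])
  then show ?thesis using parts by (simp add: br_simps eig_def)
qed

end

section \<open>One-parameter groups and analytic families of operators\<close>

text \<open>This is the exponential of \<open>t A\<close>, with the powers of \<open>t\<close> kept
  as outer factors so that each coordinate is visibly a power series in \<open>t\<close>.\<close>

definition flow :: "('a::euclidean_space \<Rightarrow> 'a) \<Rightarrow> real \<Rightarrow> 'a \<Rightarrow> 'a" where
  "flow A t v = (\<Sum>n. t ^ n *\<^sub>R ((A ^^ n) v /\<^sub>R fact n))"

lemma linear_funpow:
  fixes A :: "'a::real_vector \<Rightarrow> 'a"
  assumes "linear A"
  shows "linear (A ^^ n)"
proof (induction n)
  case 0
  show ?case by (simp add: id_def linear_iff)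
next
  case (Suc n)
  then show ?case using linear_compose[OF Suc assms] by (simp add: o_def)
qed

lemma norm_funpow_le:
  fixes A :: "'a::euclidean_space \<Rightarrow> 'a"
  assumes "linear A"
  shows "\<exists>K. \<forall>n v. norm ((A ^^ n) v) \<le> K ^ n * norm v"
proof -
  obtain K where K: "K > 0" "\<And>x. norm (A x) \<le> K * norm x"
    using linear_bounded_pos[OF assms] by blast
  have "norm ((A ^^ n) v) \<le> K ^ n * norm v" for n v
  proof (induction n)
    case (Suc n)
    have "norm (A ((A ^^ n) v)) \<le> K * norm ((A ^^ n) v)" by (rule K)
    also have "\<dots> \<le> K * (K ^ n * norm v)" using Suc K(1) by simp
    finally show ?case by simp
  qed simp
  then show ?thesis by blast
qed

text \<open>The scalar type of \<open>z\<close> is left general: the real case serves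
  differentiation in \<open>t\<close>, the complex case the entire extension.\<close>

lemma summable_flow_coeff:
  fixes A :: "'a::euclidean_space \<Rightarrow> 'a" and z :: "'b::{real_normed_field,banach}"
  assumes "linear A"
  shows "summable (\<lambda>n. of_real ((A ^^ n) v \<bullet> b / fact n) * z ^ n)"
proof -
  obtain K where K: "\<And>n v. norm ((A ^^ n) v) \<le> K ^ n * norm v"
    using norm_funpow_le[OF assms] by blast
  show ?thesis
  proof (rule summable_comparison_test')
    show "summable (\<lambda>n. (norm v * norm b) * (inverse (fact n) * (K * norm z) ^ n))"
      by (intro summable_mult summable_exp)
    fix n
    have "\<bar>(A ^^ n) v \<bullet> b\<bar> \<le> norm ((A ^^ n) v) * norm b" by (rule Cauchy_Schwarz_ineq2)
    also have "\<dots> \<le> K ^ n * norm v * norm b" by (intro mult_right_mono K) simp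
    finally have "\<bar>(A ^^ n) v \<bullet> b\<bar> * (norm z ^ n / fact n) \<le> K ^ n * norm v * norm b * (norm z ^ n / fact n)"
      by (rule mult_right_mono) simp
    then show "norm (of_real ((A ^^ n) v \<bullet> b / fact n) * z ^ n)
        \<le> (norm v * norm b) * (inverse (fact n) * (K * norm z) ^ n)"
      by (simp add: norm_mult norm_power norm_divide power_mult_distrib field_simps)
  qed
qed

lemma summable_flow:
  fixes A :: "'a::euclidean_space \<Rightarrow> 'a"
  assumes "linear A"
  shows "summable (\<lambda>n. t ^ n *\<^sub>R ((A ^^ n) v /\<^sub>R fact n))"
proof -
  obtain K where K: "\<And>n v. norm ((A ^^ n) v) \<le> K ^ n * norm v"
    using norm_funpow_le[OF assms] by blast
  show ?thesis
  proof (rule summable_comparison_test')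
    show "summable (\<lambda>n. norm v * (inverse (fact n) * (K * \<bar>t\<bar>) ^ n))"
      by (intro summable_mult summable_exp)
    fix n
    have "norm ((A ^^ n) v) * (\<bar>t\<bar> ^ n / fact n) \<le> K ^ n * norm v * (\<bar>t\<bar> ^ n / fact n)"
      by (intro mult_right_mono K) simp
    then show "norm (t ^ n *\<^sub>R ((A ^^ n) v /\<^sub>R fact n)) \<le> norm v * (inverse (fact n) * (K * \<bar>t\<bar>) ^ n)"
      by (simp add: power_abs power_mult_distrib field_simps)
  qed
qed

lemma flow_inner:
  fixes A :: "'a::euclidean_space \<Rightarrow> 'a"
  assumes "linear A"
  shows "flow A t v \<bullet> b = (\<Sum>n. ((A ^^ n) v \<bullet> b / fact n) * t ^ n)"
  unfolding flow_def bounded_linear.suminf[OF bounded_linear_inner_left summable_flow[OF assms]]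
  by (simp add: field_simps)

lemma flow_0:
  fixes A :: "'a::euclidean_space \<Rightarrow> 'a"
  shows "flow A 0 v = v"
proof -
  have "(\<lambda>n. 0 ^ n *\<^sub>R ((A ^^ n) v /\<^sub>R fact n)) sums (0 ^ 0 *\<^sub>R ((A ^^ 0) v /\<^sub>R fact 0))"
    using sums_finite[of "{0::nat}" "\<lambda>n. 0 ^ n *\<^sub>R ((A ^^ n) v /\<^sub>R fact n)"] by simp
  then show ?thesis by (simp add: flow_def sums_iff)
qed

text \<open>Each coordinate is differentiated term by term; the factor \<open>Suc n\<close> from
  \<open>diffs\<close> cancels in the factorial, and the index shift leaves one extra application of
  \<open>A\<close>.\<close>

lemma flow_vector_derivative:
  fixes A :: "'a::euclidean_space \<Rightarrow> 'a"
  assumes A: "linear A"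
  shows "((\<lambda>t. flow A t v) has_vector_derivative A (flow A t v)) (at t)"
proof -
  have comp: "((\<lambda>t. flow A t v \<bullet> b) has_field_derivative A (flow A t v) \<bullet> b) (at t)" for b
  proof -
    let ?c = "\<lambda>n. (A ^^ n) v \<bullet> b / fact n"
    have "((\<lambda>t. \<Sum>n. ?c n * t ^ n) has_field_derivative (\<Sum>n. diffs ?c n * t ^ n)) (at t)"
      using summable_flow_coeff[OF A, of v b, where 'b = real]
      by (intro termdiffs_strong_converges_everywhere) simp
    moreover have "(\<Sum>n. diffs ?c n * t ^ n) = A (flow A t v) \<bullet> b"
    proof -
      have lin: "bounded_linear (\<lambda>x. A x \<bullet> b)"
        using bounded_linear_compose[OF bounded_linear_inner_left linear_conv_bounded_linear[THEN iffD1, OF A]] .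
      have "A (flow A t v) \<bullet> b = (\<Sum>n. A (t ^ n *\<^sub>R ((A ^^ n) v /\<^sub>R fact n)) \<bullet> b)"
        unfolding flow_def by (rule bounded_linear.suminf[OF lin summable_flow[OF A]])
      also have "\<dots> = (\<Sum>n. diffs ?c n * t ^ n)"
        by (intro suminf_cong)
           (simp add: diffs_def linear_scale[OF A] divide_inverse fact_Suc del: of_nat_Suc)
      finally show ?thesis by simp
    qed
    ultimately show ?thesis by (simp add: flow_inner[OF A])
  qed
  show ?thesis
    unfolding has_vector_derivative_def
    by (subst has_derivative_componentwise_within)
       (use comp in \<open>auto simp: has_field_derivative_def mult.commute[of "_ \<bullet> _"] mult_commute_abs\<close>)
qed

text \<open>Gronwall: \<open>exp (- 2 K t) |w t|\<^sup>2\<close> is non-increasing for the difference \<open>w\<close> of two solutions.\<close>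

lemma linear_ode_unique:
  fixes A :: "'a::euclidean_space \<Rightarrow> 'a"
  assumes A: "linear A"
    and f: "\<And>t. (f has_vector_derivative A (f t)) (at t)"
    and g: "\<And>t. (g has_vector_derivative A (g t)) (at t)"
    and "f 0 = g 0" "0 \<le> t"
  shows "f t = g t"
proof -
  obtain K where K: "\<And>x. norm (A x) \<le> K * norm x"
    using linear_bounded_pos[OF A] by blast
  define w where "w t = f t - g t" for t
  have w: "(w has_vector_derivative A (w t)) (at t)" for t
    unfolding w_def using has_vector_derivative_diff[OF f g] by (simp add: linear_diff[OF A])
  define E where "E t = exp (- (2 * K * t)) * (w t \<bullet> w t)" for t
  have wn: "((\<lambda>t. w t \<bullet> w t) has_field_derivative 2 * (A (w t) \<bullet> w t)) (at t)" for t
  proof -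
    have "((\<lambda>t. w t \<bullet> w t) has_derivative (\<lambda>h. w t \<bullet> (h *\<^sub>R A (w t)) + (h *\<^sub>R A (w t)) \<bullet> w t)) (at t)"
      by (rule has_derivative_inner[OF w[unfolded has_vector_derivative_def] w[unfolded has_vector_derivative_def]])
    moreover have "(\<lambda>h. w t \<bullet> (h *\<^sub>R A (w t)) + (h *\<^sub>R A (w t)) \<bullet> w t) = (*) (2 * (A (w t) \<bullet> w t))"
      by (simp add: fun_eq_iff inner_commute[of "w t"])
    ultimately show ?thesis by (simp add: has_field_derivative_def)
  qed
  have dE: "(E has_field_derivative
      exp (- (2 * K * t)) * (2 * (A (w t) \<bullet> w t)) + exp (- (2 * K * t)) * (- (2 * K)) * (w t \<bullet> w t)) (at t)" for t
    unfolding E_def by (auto intro!: derivative_eq_intros wn)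
  have "E t \<le> E 0"
  proof (rule DERIV_nonpos_imp_nonincreasing[OF \<open>0 \<le> t\<close>])
    fix s :: real
    have "A (w s) \<bullet> w s \<le> norm (A (w s)) * norm (w s)" by (rule norm_cauchy_schwarz)
    also have "\<dots> \<le> (K * norm (w s)) * norm (w s)" by (intro mult_right_mono K) simp
    also have "\<dots> = K * (w s \<bullet> w s)" by (simp add: power2_norm_eq_inner[symmetric] power2_eq_square)
    finally have "exp (- (2 * K * s)) * (A (w s) \<bullet> w s - K * (w s \<bullet> w s)) \<le> 0"
      by (simp add: mult_nonneg_nonpos)
    then have "exp (- (2 * K * s)) * (2 * (A (w s) \<bullet> w s)) + exp (- (2 * K * s)) * (- (2 * K)) * (w s \<bullet> w s) \<le> 0"
      by (simp add: algebra_simps)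
    then show "\<exists>y. (E has_real_derivative y) (at s) \<and> y \<le> 0"
      using dE by blast
  qed
  also have "E 0 = 0" using assms(4) by (simp add: E_def w_def)
  finally have "w t \<bullet> w t \<le> 0" by (simp add: E_def mult_le_0_iff)
  then have "w t = 0" using inner_ge_zero[of "w t"] by (simp add: order_antisym_conv)
  then show ?thesis by (simp add: w_def)
qed

lemma flow_linear:
  fixes A :: "'a::euclidean_space \<Rightarrow> 'a"
  assumes A: "linear A"
  shows "linear (flow A t)"
proof -
  have lin: "linear (\<lambda>v. t ^ n *\<^sub>R ((A ^^ n) v /\<^sub>R fact n))" for n
    using linear_funpow[OF A, of n] by (simp add: linear_iff algebra_simps)
  show ?thesis
  proof (rule linearI)
    fix x y c
    show "flow A t (x + y) = flow A t x + flow A t y"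
      unfolding flow_def linear_add[OF lin] by (intro suminf_add[symmetric] summable_flow[OF A])
    show "flow A t (c *\<^sub>R x) = c *\<^sub>R flow A t x"
      unfolding flow_def linear_scale[OF lin] by (intro suminf_scaleR_right[symmetric] summable_flow[OF A])
  qed
qed

lemma flow_scaled:
  fixes A :: "'a::euclidean_space \<Rightarrow> 'a"
  assumes A: "linear A"
  shows "flow (\<lambda>v. c *\<^sub>R A v) t v = flow A (c * t) v"
proof -
  have "((\<lambda>v. c *\<^sub>R A v) ^^ n) v = c ^ n *\<^sub>R (A ^^ n) v" for n
    by (induction n) (simp_all add: linear_scale[OF A])
  then show ?thesis by (simp add: flow_def power_mult_distrib mult_ac)
qed

text \<open>Two solutions of \<open>u' = A u\<close> with initial value \<open>flow A (-1) v\<close>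
  are compared at time 1, instead of multiplying exponential series.\<close>

lemma flow_inverse:
  fixes A :: "'a::euclidean_space \<Rightarrow> 'a"
  assumes A: "linear A"
  shows "flow A 1 (flow A (-1) v) = v"
proof -
  have der: "((\<lambda>t. flow A (t + (-1)) v) has_vector_derivative A (flow A (t + (-1)) v)) (at t)" for t
    using vector_diff_chain_at[of "\<lambda>t. t + (-1)" 1 t "\<lambda>t. flow A t v",
        OF _ flow_vector_derivative[OF A]]
    by (simp add: o_def has_vector_derivative_diff_const)
  have "flow A 1 (flow A (-1) v) = flow A (1 + (-1)) v"
    by (rule linear_ode_unique[OF A flow_vector_derivative[OF A, where v = "flow A (-1) v"] der])
       (simp_all add: flow_0)
  then show ?thesis by (simp add: flow_0)
qed

section \<open>Real functions with entire extensions, and generic injectivity\<close>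

definition entire_real :: "(real \<Rightarrow> real) \<Rightarrow> bool" where
  "entire_real f \<longleftrightarrow> (\<exists>F. F holomorphic_on UNIV \<and> (\<forall>t. F (of_real t) = complex_of_real (f t)))"

lemma entire_real_const: "entire_real (\<lambda>t. c)"
  unfolding entire_real_def by (rule exI[of _ "\<lambda>z. of_real c"]) simp

lemma entire_real_add:
  assumes "entire_real f" "entire_real g"
  shows "entire_real (\<lambda>t. f t + g t)"
proof -
  obtain F G where "F holomorphic_on UNIV" "\<And>t. F (of_real t) = complex_of_real (f t)"
      "G holomorphic_on UNIV" "\<And>t. G (of_real t) = complex_of_real (g t)"
    using assms unfolding entire_real_def by blast
  then show ?thesis
    unfolding entire_real_def by (intro exI[of _ "\<lambda>z. F z + G z"]) (simp add: holomorphic_on_add)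
qed

lemma entire_real_mult:
  assumes "entire_real f" "entire_real g"
  shows "entire_real (\<lambda>t. f t * g t)"
proof -
  obtain F G where "F holomorphic_on UNIV" "\<And>t. F (of_real t) = complex_of_real (f t)"
      "G holomorphic_on UNIV" "\<And>t. G (of_real t) = complex_of_real (g t)"
    using assms unfolding entire_real_def by blast
  then show ?thesis
    unfolding entire_real_def by (intro exI[of _ "\<lambda>z. F z * G z"]) (simp add: holomorphic_on_mult)
qed

lemma entire_real_sum: "(\<And>i. i \<in> I \<Longrightarrow> entire_real (f i)) \<Longrightarrow> entire_real (\<lambda>t. \<Sum>i\<in>I. f i t)"
  by (induction I rule: infinite_finite_induct) (auto intro: entire_real_add entire_real_const)

lemma entire_real_prod: "(\<And>i. i \<in> I \<Longrightarrow> entire_real (f i)) \<Longrightarrow> entire_real (\<lambda>t. \<Prod>i\<in>I. f i t)"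
  by (induction I rule: infinite_finite_induct) (auto intro: entire_real_mult entire_real_const)

lemma entire_real_det:
  fixes M :: "real \<Rightarrow> real^'n^'n"
  assumes "\<And>i j. entire_real (\<lambda>t. M t $ i $ j)"
  shows "entire_real (\<lambda>t. det (M t))"
  unfolding det_def by (intro entire_real_sum entire_real_mult entire_real_const entire_real_prod assms)

text \<open>Zeros of a nonzero entire function are isolated, so one nonzero value anywhere controls
  a punctured neighbourhood of every point. This is what the extension in \<open>entire_real\<close>
  is for.\<close>

lemma entire_real_eventually_nonzero:
  assumes "entire_real f" "f t0 \<noteq> 0"
  shows "eventually (\<lambda>t. f t \<noteq> 0) (at s)"
proof -
  obtain F where F: "F holomorphic_on UNIV" "\<And>t. F (of_real t) = complex_of_real (f t)"
    using assms(1) unfolding entire_real_def by blast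
  have "eventually (\<lambda>w. F w \<noteq> 0 \<and> w \<in> UNIV) (at (complex_of_real s))"
    by (rule non_zero_neighbour_alt[OF F(1), of _ "complex_of_real t0"]) (use F(2) assms(2) in auto)
  moreover have "filterlim complex_of_real (at (complex_of_real s)) (at s)"
    by (auto simp: filterlim_at eventually_at_filter intro!: tendsto_intros)
  ultimately have "eventually (\<lambda>t. F (of_real t) \<noteq> 0) (at s)"
    by (auto dest: eventually_compose_filterlim)
  then show ?thesis by (simp add: F(2))
qed

lemma entire_real_flow:
  fixes A :: "'a::euclidean_space \<Rightarrow> 'a"
  assumes A: "linear A"
  shows "entire_real (\<lambda>t. flow A t v \<bullet> b)"
proof -
  let ?c = "\<lambda>n. (A ^^ n) v \<bullet> b / fact n"
  let ?F = "\<lambda>z::complex. \<Sum>n. of_real (?c n) * z ^ n"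
  have "?F holomorphic_on UNIV"
    unfolding holomorphic_on_def field_differentiable_def
    using termdiffs_strong_converges_everywhere[OF summable_flow_coeff[OF A, of v b, where 'b = complex]]
    by blast
  moreover have "?F (of_real t) = of_real (flow A t v \<bullet> b)" for t
  proof -
    have "summable (\<lambda>n. ?c n * t ^ n)"
      using summable_flow_coeff[OF A, of v b, where 'b = real] by simp
    then show ?thesis
      unfolding flow_inner[OF A] by (subst suminf_of_real) simp_all
  qed
  ultimately show ?thesis unfolding entire_real_def by blast
qed

definition entire_family :: "(real \<Rightarrow> 'a::euclidean_space \<Rightarrow> 'a) \<Rightarrow> bool" where
  "entire_family M \<longleftrightarrow> (\<forall>t. linear (M t)) \<and> (\<forall>v b. entire_real (\<lambda>t. M t v \<bullet> b))"

lemma entire_family_const: "linear L \<Longrightarrow> entire_family (\<lambda>t. L)"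
  by (simp add: entire_family_def entire_real_const)

lemma entire_family_flow:
  fixes A :: "'a::euclidean_space \<Rightarrow> 'a"
  shows "linear A \<Longrightarrow> entire_family (flow A)"
  by (simp add: entire_family_def entire_real_flow flow_linear)

lemma entire_family_add:
  "entire_family M \<Longrightarrow> entire_family N \<Longrightarrow> entire_family (\<lambda>t v. M t v + N t v)"
  by (simp add: entire_family_def inner_add_left entire_real_add linear_compose_add)

text \<open>Composition is matrix multiplication in coordinates, hence a finite sum of products of
  entire functions.\<close>

lemma entire_family_compose:
  fixes M N :: "real \<Rightarrow> 'a::euclidean_space \<Rightarrow> 'a"
  assumes M: "entire_family M" and N: "entire_family N"
  shows "entire_family (\<lambda>t v. M t (N t v))"
proof -
  have "M t (N t v) \<bullet> b = (\<Sum>i\<in>Basis. (N t v \<bullet> i) * (M t i \<bullet> b))" for t v b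
  proof -
    have "linear (M t)" using M by (simp add: entire_family_def)
    then have "M t (\<Sum>i\<in>Basis. (N t v \<bullet> i) *\<^sub>R i) = (\<Sum>i\<in>Basis. (N t v \<bullet> i) *\<^sub>R M t i)"
      by (simp add: linear_sum linear_scale)
    then show ?thesis by (simp add: euclidean_representation inner_sum_left)
  qed
  moreover have "linear (\<lambda>v. M t (N t v))" for t
    using M N linear_compose[of "N t" "M t"] by (simp add: entire_family_def o_def)
  ultimately show ?thesis
    using M N by (simp add: entire_family_def entire_real_sum entire_real_mult)
qed

text \<open>An index type for the coordinates of a Euclidean space makes the determinants of
  \<open>real^'n^'n\<close> available for its endomorphisms.\<close>

typedef (overloaded) ('a::euclidean_space) basis_index = "Basis :: 'a set"
  using nonempty_Basis by blast

instance basis_index :: (euclidean_space) finite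
proof
  have "(UNIV :: 'a basis_index set) = Abs_basis_index ` Basis"
    by (auto intro: Abs_basis_index_cases)
  then show "finite (UNIV :: 'a basis_index set)" by (metis finite_imageI finite_Basis)
qed

definition coords :: "'a::euclidean_space \<Rightarrow> real^'a basis_index" where
  "coords v = (\<chi> i. v \<bullet> Rep_basis_index i)"

lemma inner_Rep_basis_index:
  "Rep_basis_index i \<bullet> Rep_basis_index j = (if i = j then 1 else 0)"
  by (simp add: inner_Basis Rep_basis_index Rep_basis_index_inject)

lemma sum_Rep_basis_index:
  fixes f :: "'a::euclidean_space \<Rightarrow> 'b::comm_monoid_add"
  shows "(\<Sum>b\<in>Basis. f b) = (\<Sum>i\<in>UNIV. f (Rep_basis_index i))"
proof -
  have "range (Rep_basis_index :: 'a basis_index \<Rightarrow> 'a) = Basis"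
    using type_definition.Rep_range[OF type_definition_basis_index] .
  moreover have "inj (Rep_basis_index :: 'a basis_index \<Rightarrow> 'a)"
    by (simp add: inj_def Rep_basis_index_inject)
  ultimately show ?thesis
    using sum.reindex[of Rep_basis_index UNIV f] by simp
qed

lemma bij_coords: "bij (coords :: 'a::euclidean_space \<Rightarrow> _)"
proof (rule bijI)
  show "inj (coords :: 'a \<Rightarrow> _)"
  proof (rule injI, rule euclidean_eqI)
    fix x y b :: 'a
    assume "coords x = coords y" "b \<in> Basis"
    then show "x \<bullet> b = y \<bullet> b"
      by (auto simp: coords_def vec_eq_iff elim: Rep_basis_index_cases)
  qed
  show "surj (coords :: 'a \<Rightarrow> _)"
  proof (rule surjI)
    fix w
    show "coords (\<Sum>i\<in>UNIV. w $ i *\<^sub>R Rep_basis_index i :: 'a) = w"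
      by (simp add: coords_def vec_eq_iff inner_sum_left inner_Rep_basis_index if_distrib cong: if_cong)
  qed
qed

definition operator_det :: "('a::euclidean_space \<Rightarrow> 'a) \<Rightarrow> real" where
  "operator_det L = det (\<chi> i j. L (Rep_basis_index j) \<bullet> Rep_basis_index i)"

text \<open>\<open>coords\<close> intertwines \<open>L\<close> with its matrix \<open>?N\<close>,
  which reduces the claim to the determinant criterion for matrices.\<close>

lemma operator_det_nz_iff:
  fixes L :: "'a::euclidean_space \<Rightarrow> 'a"
  assumes L: "linear L"
  shows "operator_det L \<noteq> 0 \<longleftrightarrow> inj L"
proof -
  let ?N = "\<chi> i j. L (Rep_basis_index j) \<bullet> Rep_basis_index i"
  have N: "?N *v coords v = coords (L v)" for v
  proof -
    have "L v = (\<Sum>i\<in>Basis. (v \<bullet> i) *\<^sub>R L i)"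
      using arg_cong[OF euclidean_representation[of v], of L] by (simp add: linear_sum[OF L] linear_scale[OF L])
    then have "L v = (\<Sum>i\<in>UNIV. (v \<bullet> Rep_basis_index i) *\<^sub>R L (Rep_basis_index i))"
      by (simp add: sum_Rep_basis_index)
    then show ?thesis
      by (simp add: coords_def matrix_vector_mult_def vec_eq_iff inner_sum_left mult.commute)
  qed
  have inj: "inj (coords :: 'a \<Rightarrow> _)" and surj: "surj (coords :: 'a \<Rightarrow> _)"
    and inv: "inj (inv (coords :: 'a \<Rightarrow> _))"
    using bij_coords bij_imp_bij_inv[OF bij_coords] by (auto simp only: bij_def)
  have "((*v) ?N \<circ> coords) \<circ> inv coords = (*v) ?N"
    by (simp add: fun_eq_iff surj_f_inv_f[OF surj])
  then have "inj ((*v) ?N) \<longleftrightarrow> inj ((*v) ?N \<circ> coords)"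
    using inj_compose[OF _ inj, of "(*v) ?N"] inj_compose[OF _ inv, of "(*v) ?N \<circ> coords"] by argo
  also have "(*v) ?N \<circ> coords = coords \<circ> L"
    by (simp add: fun_eq_iff N)
  also have "inj (coords \<circ> L) \<longleftrightarrow> inj L"
    using inj_compose[OF inj, of L] inj_on_imageI2[of coords L UNIV] by argo
  finally show ?thesis
    unfolding operator_det_def using det_nz_iff_inj[OF matrix_vector_mul_linear, of ?N] by simp
qed

text \<open>Injectivity is the non-vanishing of an entire determinant, so a single good parameter
  \<open>t0\<close> makes it generic near any \<open>s\<close>.\<close>

lemma entire_family_eventually_inj:
  fixes M :: "real \<Rightarrow> 'a::euclidean_space \<Rightarrow> 'a"
  assumes M: "entire_family M" and "inj (M t0)"
  shows "eventually (\<lambda>t. inj (M t)) (at s)"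
proof -
  have lin: "linear (M t)" for t using M by (simp add: entire_family_def)
  have "entire_real (\<lambda>t. operator_det (M t))"
    unfolding operator_det_def using M by (intro entire_real_det) (simp add: entire_family_def)
  then have "eventually (\<lambda>t. operator_det (M t) \<noteq> 0) (at s)"
    by (rule entire_real_eventually_nonzero[of _ t0]) (simp add: operator_det_nz_iff lin assms(2))
  then show ?thesis by (simp add: operator_det_nz_iff lin)
qed

section \<open>Inner automorphisms\<close>

text \<open>With \<open>P\<close> a projection, this is the block-diagonal operator with the compression of \<open>L\<close> to the
  range of \<open>P\<close> and the identity on the kernel of \<open>P\<close>.\<close>

definition corner :: "('a::real_vector \<Rightarrow> 'a) \<Rightarrow> ('a \<Rightarrow> 'a) \<Rightarrow> 'a \<Rightarrow> 'a" where
  "corner P L v = P (L (P v)) + (v - P v)"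

lemma corner_inj:
  assumes "linear P" "linear L" "inj (corner P L)" "P v = v" "P (L v) = 0"
  shows "v = 0"
proof -
  have "corner P L v = corner P L 0"
    using assms(4,5) by (simp add: corner_def linear_0[OF assms(1)] linear_0[OF assms(2)])
  then show ?thesis using assms(3) by (simp add: inj_eq)
qed

text \<open>In finite dimension the injective corner operator is onto. Applying \<open>P\<close> to
  \<open>corner P L v = w\<close> removes the summand in the kernel of \<open>P\<close>, so
  \<open>P v\<close> is the witness.\<close>

lemma corner_surj:
  fixes P :: "'a::euclidean_space \<Rightarrow> 'a"
  assumes P: "linear P" and L: "linear L" and "inj (corner P L)"
    and idem: "\<And>v. P (P v) = P v" and w: "P w = w"
  obtains v where "P v = v" "P (L v) = w"
proof -
  have "linear (corner P L)"
    unfolding corner_def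
    by (rule linearI)
       (simp_all add: linear_add[OF P] linear_add[OF L] linear_scale[OF P] linear_scale[OF L] algebra_simps)
  then have "surj (corner P L)"
    using assms(3) by (rule eucl.linear_inj_imp_surj)
  then obtain v where v: "corner P L v = w" by (metis surjD)
  have "P (corner P L v) = P (L (P v))"
    by (simp add: corner_def linear_add[OF P] linear_diff[OF P] idem)
  then have "P (L (P v)) = w" using v w by simp
  then show ?thesis using that[of "P v"] idem by simp
qed

lemma entire_family_corner:
  assumes "linear P" "entire_family M"
  shows "entire_family (\<lambda>t. corner P (M t))"
proof -
  have "entire_family (\<lambda>t v. P (M t (P v)))"
    using entire_family_compose[OF entire_family_const[OF assms(1)]
        entire_family_compose[OF assms(2) entire_family_const[OF assms(1)]]] .
  moreover have "linear (\<lambda>v. v - P v)"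
    by (intro linear_compose_sub linear_id[unfolded id_def] assms)
  ultimately show ?thesis
    unfolding corner_def by (intro entire_family_add entire_family_const)
qed

section \<open>Exponentials of \<open>ad y\<close> as automorphisms, and analytic paths to inner
  automorphisms\<close>

lemma exp_ad_eq_flow: "exp_ad br y = flow (br y) 1"
  by (simp add: exp_ad_def flow_def fun_eq_iff)

locale simple_euclidean = simple_alg br for br :: "'a::euclidean_space \<Rightarrow> 'a \<Rightarrow> 'a"
begin

lemma br_vector_derivative:
  assumes "(f has_vector_derivative f') (at t)" "(g has_vector_derivative g') (at t)"
  shows "((\<lambda>t. br (f t) (g t)) has_vector_derivative (br (f t) g' + br f' (g t))) (at t)"
  using bilin assms unfolding bilinear_conv_bounded_bilinear by (rule bounded_bilinear.has_vector_derivative)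

definition lie_aut :: "('a \<Rightarrow> 'a) \<Rightarrow> bool" where
  "lie_aut f \<longleftrightarrow> linear f \<and> bij f \<and> (\<forall>a b. f (br a b) = br (f a) (f b))"

lemma exp_ad_scaled: "exp_ad br (t *\<^sub>R y) = flow (br y) t"
proof -
  have "br (t *\<^sub>R y) = (\<lambda>v. t *\<^sub>R br y v)" by (simp add: fun_eq_iff br_simps)
  then have "exp_ad br (t *\<^sub>R y) = flow (\<lambda>v. t *\<^sub>R br y v) 1"
    by (simp only: exp_ad_eq_flow)
  then show ?thesis by (simp add: fun_eq_iff flow_scaled[OF linear_br])
qed

lemma exp_ad_inverse: "exp_ad br y (exp_ad br (- y) v) = v"
  using flow_inverse[OF linear_br, of y v] exp_ad_scaled[of "-1" y] exp_ad_scaled[of 1 y] by simp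

lemma bij_exp_ad: "bij (exp_ad br y)"
  using exp_ad_inverse[of y] exp_ad_inverse[of "- y"]
  by (intro o_bij[of "exp_ad br (- y)"]) (simp_all add: fun_eq_iff)

lemma inv_exp_ad: "inv (exp_ad br y) = exp_ad br (- y)"
  using exp_ad_inverse[of y] exp_ad_inverse[of "- y"]
  by (intro inv_unique_comp) (simp_all add: fun_eq_iff)

text \<open>By the Jacobi identity \<open>ad y\<close> is a derivation, so the bracket of two flow
  lines solves \<open>u' = [y, u]\<close>, as does the flow line of the bracket; both start at
  \<open>br a b\<close>.\<close>

lemma exp_ad_aut: "lie_aut (exp_ad br y)"
  unfolding lie_aut_def
proof (intro conjI allI)
  show "linear (exp_ad br y)" unfolding exp_ad_eq_flow by (rule flow_linear[OF linear_br])
  show "bij (exp_ad br y)" by (rule bij_exp_ad)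
  fix a b
  let ?F = "flow (br y)"
  note fd = flow_vector_derivative[OF linear_br[of y]]
  have der: "((\<lambda>t. br (?F t a) (?F t b)) has_vector_derivative br y (br (?F t a) (?F t b))) (at t)" for t
    unfolding jacobi[of y "?F t a" "?F t b"] add.commute[of "br (br y (?F t a)) (?F t b)"]
    by (rule br_vector_derivative[OF fd fd])
  have "?F 1 (br a b) = br (?F 1 a) (?F 1 b)"
    by (rule linear_ode_unique[OF linear_br[of y] fd[where v = "br a b"] der]) (simp_all add: flow_0)
  then show "exp_ad br y (br a b) = br (exp_ad br y a) (exp_ad br y b)"
    by (simp add: exp_ad_eq_flow)
qed

lemma lie_aut_compose: "lie_aut f \<Longrightarrow> lie_aut g \<Longrightarrow> lie_aut (\<lambda>v. f (g v))"
  using linear_compose[of g f] bij_comp[of g f] by (simp add: lie_aut_def o_def)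

text \<open>Every factor \<open>exp (ad y)\<close> is replaced by \<open>exp (t ad y)\<close>. An
  inverse factor is the exponential of \<open>ad (- y)\<close> and is treated the same way.\<close>

lemma Inn_path:
  assumes "\<phi> \<in> Inn br"
  shows "\<exists>\<Phi>. entire_family \<Phi> \<and> \<Phi> 0 = id \<and> \<Phi> 1 = \<phi> \<and> (\<forall>t. lie_aut (\<Phi> t))"
proof -
  have step: "\<exists>\<Phi>. entire_family \<Phi> \<and> \<Phi> 0 = id \<and> \<Phi> 1 = exp_ad br y \<circ> f \<and> (\<forall>t. lie_aut (\<Phi> t))"
    if ex: "\<exists>\<Phi>. entire_family \<Phi> \<and> \<Phi> 0 = id \<and> \<Phi> 1 = f \<and> (\<forall>t. lie_aut (\<Phi> t))" for f y
  proof -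
    obtain \<Phi> where \<Phi>: "entire_family \<Phi>" "\<Phi> 0 = id" "\<Phi> 1 = f" "\<And>t. lie_aut (\<Phi> t)"
      using ex by blast
    have aut: "lie_aut (flow (br y) t)" for t
      using exp_ad_aut[of "t *\<^sub>R y"] by (simp add: exp_ad_scaled)
    let ?\<Psi> = "\<lambda>t v. flow (br y) t (\<Phi> t v)"
    have "entire_family ?\<Psi>"
      by (rule entire_family_compose[OF entire_family_flow[OF linear_br] \<Phi>(1)])
    moreover have "?\<Psi> 0 = id" "?\<Psi> 1 = exp_ad br y \<circ> f"
      by (simp_all add: fun_eq_iff flow_0 \<Phi>(2,3) exp_ad_eq_flow)
    moreover have "lie_aut (?\<Psi> t)" for t
      by (rule lie_aut_compose[OF aut \<Phi>(4)])
    ultimately show ?thesis by blast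
  qed
  show ?thesis
    using assms
  proof induction
    case Inn_id
    have "lie_aut id" by (simp add: lie_aut_def linear_iff)
    moreover have "entire_family (\<lambda>t. id :: 'a \<Rightarrow> 'a)"
      by (rule entire_family_const) (simp add: linear_iff)
    ultimately show ?case
      by (intro exI[of _ "\<lambda>t. id"] conjI allI) (assumption | rule refl)+
  next
    case (Inn_exp f y)
    then show ?case by (intro step)
  next
    case (Inn_inv f y)
    then show ?case unfolding inv_exp_ad by (intro step)
  qed
qed

lemma lie_aut_eig:
  assumes "lie_aut f" "v \<in> eig br x \<mu>"
  shows "f v \<in> eig br (f x) \<mu>"
proof -
  have "br (f x) (f v) = f (br x v)" using assms(1) by (simp add: lie_aut_def)
  also have "\<dots> = \<mu> *\<^sub>R f v"
    using assms by (simp add: lie_aut_def eig_def linear_scale)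
  finally show ?thesis by (simp add: eig_def)
qed

lemma lie_aut_inv:
  assumes "lie_aut f"
  shows "lie_aut (inv f)"
proof -
  have f: "linear f" "bij f" "\<And>a b. f (br a b) = br (f a) (f b)"
    using assms by (auto simp: lie_aut_def)
  have inj: "inj f" and surj: "\<And>v. f (inv f v) = v"
    using f(2) by (auto simp: bij_def surj_f_inv_f)
  have "linear (inv f)"
    by (rule linearI; rule injD[OF inj]) (simp_all add: surj linear_add[OF f(1)] linear_scale[OF f(1)])
  moreover have "inv f (br a b) = br (inv f a) (inv f b)" for a b
    by (rule injD[OF inj]) (simp add: surj f(3))
  ultimately show ?thesis using f(2) by (simp add: lie_aut_def bij_imp_bij_inv)
qed

lemma lie_aut_euler:
  assumes f: "lie_aut f" and x: "euler br x"
  shows "euler br (f x)"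
  unfolding euler_iff
proof (intro conjI allI)
  have lin: "linear f" and bij: "bij f" and hom: "\<And>a b. br (f a) (f b) = f (br a b)"
    using f by (auto simp: lie_aut_def)
  show "f x \<noteq> 0"
    using x injD[OF bij_is_inj[OF bij], of x 0] linear_0[OF lin] by (metis euler_def)
  fix y
  obtain u where "y = f u" using bij by (metis bij_pointE)
  then show "br (f x) (br (f x) (br (f x) y)) = br (f x) y"
    by (simp add: hom euler_cubic[OF x])
qed

section \<open>Rotations and the three-dimensional subalgebra\<close>

lemma exp_ad_rotation:
  assumes "br z h = - x" "br z x = h" "0 \<le> t"
  shows "exp_ad br (t *\<^sub>R z) h = cos t *\<^sub>R h - sin t *\<^sub>R x"
  unfolding exp_ad_scaled
\<comment> \<open>The hypotheses make \<open>ad z\<close> an infinitesimal rotation of the span of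
  \<open>h\<close> and \<open>x\<close>, so the explicit rotation solves the flow equation with
  initial value \<open>h\<close>.\<close>
proof (rule linear_ode_unique[OF linear_br flow_vector_derivative[OF linear_br] _ _ assms(3)])
  fix t
  have "((\<lambda>t. cos t *\<^sub>R h - sin t *\<^sub>R x) has_vector_derivative (- sin t *\<^sub>R h - cos t *\<^sub>R x)) (at t)"
    by (auto intro!: derivative_eq_intros)
  then show "((\<lambda>t. cos t *\<^sub>R h - sin t *\<^sub>R x) has_vector_derivative br z (cos t *\<^sub>R h - sin t *\<^sub>R x)) (at t)"
    by (simp add: br_simps assms(1,2) minus_diff_commute)
qed (simp add: flow_0)

lemma rotation_symmetric:
  assumes "br z h = - x" "br z x = h" "euler br h"
  shows "symmetric_euler br h"
proof -
  have "exp_ad br (pi *\<^sub>R z) h = - h"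
    using exp_ad_rotation[OF assms(1,2), of pi] by simp
  moreover have "exp_ad br (pi *\<^sub>R z) \<circ> id \<in> Inn br"
    by (intro Inn.intros)
  ultimately show ?thesis
    unfolding symmetric_euler_def using assms(3) by auto
qed

text \<open>A quarter turn conjugates \<open>h\<close> to \<open>- x\<close>; conjugation and change
  of sign both preserve Euler elements.\<close>

lemma rotation_euler:
  assumes "br z h = - x" "br z x = h" "euler br h"
  shows "euler br x"
proof -
  have "exp_ad br ((pi / 2) *\<^sub>R z) h = - x"
    using exp_ad_rotation[OF assms(1,2), of "pi / 2"] by simp
  then have "euler br (- x)"
    using lie_aut_euler[OF exp_ad_aut assms(3)] by metis
  then show ?thesis using euler_minus by fastforce
qed

lemma gen_subalgebra_sl2:
  assumes "h \<noteq> 0" and hx: "br h x = z" and hz: "br h z = x" and xz: "br x z = - h"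
  shows "iso_to_sl2 br (gen_subalgebra br {h, x})"
proof -
  have rel: "br x h = - z" "br z h = - x" "br z x = h"
    using br_anti[of x h] br_anti[of z h] br_anti[of z x] assms by simp_all
  note rels = rel hx hz xz br_self
  have comb: "br (a *\<^sub>R h + b *\<^sub>R x + c *\<^sub>R z) (a' *\<^sub>R h + b' *\<^sub>R x + c' *\<^sub>R z) =
      (c * b' - b * c') *\<^sub>R h + (a * c' - c * a') *\<^sub>R x + (a * b' - b * a') *\<^sub>R z" for a b c a' b' c'
    by (simp add: br_simps rels algebra_simps)
  have "x \<noteq> 0" using assms by (auto simp: br_simps)
  define S where "S = {a *\<^sub>R h + b *\<^sub>R x + c *\<^sub>R z | a b c. True}"
  have S: "S = span {h, x, z}"
    unfolding S_def by (auto simp: span_insert span_empty algebra_simps)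
  \<comment> \<open>\<open>ad x ad h\<close> isolates the coefficient \<open>b\<close>,
    \<open>ad h ad x\<close> isolates \<open>a\<close>, and what remains is a multiple of
    \<open>z\<close>.\<close>
  have zero: "a = 0 \<and> b = 0 \<and> c = 0" if "a *\<^sub>R h + b *\<^sub>R x + c *\<^sub>R z = 0" for a b c
  proof -
    have "br x (br h (a *\<^sub>R h + b *\<^sub>R x + c *\<^sub>R z)) = 0"
      "br h (br x (a *\<^sub>R h + b *\<^sub>R x + c *\<^sub>R z)) = 0"
      using that by (simp_all add: br_simps)
    then have "b = 0" "a = 0" using assms(1) \<open>x \<noteq> 0\<close> by (simp_all add: br_simps rels)
    moreover have "z \<noteq> 0" using hz \<open>x \<noteq> 0\<close> by (auto simp: br_simps)
    ultimately show ?thesis using that by simp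
  qed
  have gen: "gen_subalgebra br {h, x} = S"
  proof
    have "subspace S" using S by simp
    moreover have "br u v \<in> S" if u: "u \<in> S" and v: "v \<in> S" for u v
    proof -
      obtain a b c a' b' c' where uv: "u = a *\<^sub>R h + b *\<^sub>R x + c *\<^sub>R z" "v = a' *\<^sub>R h + b' *\<^sub>R x + c' *\<^sub>R z"
        using u v unfolding S_def by blast
      show ?thesis unfolding uv comb S_def by blast
    qed
    ultimately have "lie_subalgebra br S" by (simp add: lie_subalgebra_def)
    moreover have "{h, x} \<subseteq> S" unfolding S by (auto intro: span_base)
    ultimately show "gen_subalgebra br {h, x} \<subseteq> S" unfolding gen_subalgebra_def by blast
    show "S \<subseteq> gen_subalgebra br {h, x}"
      unfolding gen_subalgebra_def
    proof (rule Inter_greatest)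
      fix T assume "T \<in> {T. lie_subalgebra br T \<and> {h, x} \<subseteq> T}"
      then have "subspace T" "h \<in> T" "x \<in> T" "z \<in> T"
        using hx by (auto simp: lie_subalgebra_def)
      then show "S \<subseteq> T" unfolding S by (intro span_minimal) auto
    qed
  qed
  have "x \<noteq> z" "h \<noteq> x" "h \<noteq> z"
    using zero[of 0 1 "-1"] zero[of 1 "-1" 0] zero[of 1 0 "-1"] by auto
  have "independent {h, x, z}"
    unfolding independent_explicit
  proof (intro conjI allI impI ballI)
    fix c v assume "(\<Sum>v\<in>{h, x, z}. c v *\<^sub>R v) = 0" "v \<in> {h, x, z}"
    then show "c v = 0"
      using zero[of "c h" "c x" "c z"] \<open>x \<noteq> z\<close> \<open>h \<noteq> x\<close> \<open>h \<noteq> z\<close> by (auto simp: add.assoc)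
  qed simp
  \<comment> \<open>The matrix model: \<open>h\<close> goes to half of diag(1, -1), \<open>x\<close>
    to half of the symmetric off-diagonal matrix, and \<open>z = [h, x]\<close> to half of the skew
    one.\<close>
  define E :: "real \<Rightarrow> real \<Rightarrow> real \<Rightarrow> real^2^2" where
    "E a b c = vector [vector [a / 2, (b + c) / 2], vector [(b - c) / 2, - (a / 2)]]" for a b c
  obtain f where f: "linear f"
    and "\<forall>v\<in>{h, x, z}. f v = (if v = h then E 1 0 0 else if v = x then E 0 1 0 else E 0 0 1)"
    using linear_independent_extend[OF \<open>independent {h, x, z}\<close>,
        of "\<lambda>v. if v = h then E 1 0 0 else if v = x then E 0 1 0 else E 0 0 1"] by blast
  then have fv: "f h = E 1 0 0" "f x = E 0 1 0" "f z = E 0 0 1"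
    using \<open>x \<noteq> z\<close> \<open>h \<noteq> x\<close> \<open>h \<noteq> z\<close> by simp_all
  have fS: "f (a *\<^sub>R h + b *\<^sub>R x + c *\<^sub>R z) = E a b c" for a b c
    by (simp add: linear_add[OF f] linear_scale[OF f] fv E_def vec_eq_iff forall_2 field_simps)
  have "bij_betw f S sl2"
  proof (rule bij_betwI')
    fix u v assume "u \<in> S" "v \<in> S"
    then obtain a b c a' b' c' where uv: "u = a *\<^sub>R h + b *\<^sub>R x + c *\<^sub>R z" "v = a' *\<^sub>R h + b' *\<^sub>R x + c' *\<^sub>R z"
      unfolding S_def by blast
    have "E a b c = E a' b' c' \<longleftrightarrow> a = a' \<and> b = b' \<and> c = c'"
      by (auto simp: E_def vec_eq_iff forall_2)
    then have "f u = f v \<Longrightarrow> u = v" unfolding uv fS by auto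
    then show "f u = f v \<longleftrightarrow> u = v" by blast
  next
    fix u assume "u \<in> S"
    then show "f u \<in> sl2"
      unfolding S_def by (auto simp: fS E_def sl2_def trace_def sum_2)
  next
    fix M assume "M \<in> sl2"
    then have "M $ 1 $ 1 + M $ 2 $ 2 = 0" by (simp add: sl2_def trace_def sum_2)
    then have "M = E (2 * M $ 1 $ 1) (M $ 1 $ 2 + M $ 2 $ 1) (M $ 1 $ 2 - M $ 2 $ 1)"
      by (simp add: E_def vec_eq_iff forall_2)
    then have "M = f ((2 * M $ 1 $ 1) *\<^sub>R h + (M $ 1 $ 2 + M $ 2 $ 1) *\<^sub>R x + (M $ 1 $ 2 - M $ 2 $ 1) *\<^sub>R z)"
      by (simp only: fS)
    then show "\<exists>u\<in>S. M = f u" unfolding S_def by blast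
  qed
  moreover have "f (br u v) = f u ** f v - f v ** f u" if u: "u \<in> S" and v: "v \<in> S" for u v
  proof -
    obtain a b c a' b' c' where uv: "u = a *\<^sub>R h + b *\<^sub>R x + c *\<^sub>R z" "v = a' *\<^sub>R h + b' *\<^sub>R x + c' *\<^sub>R z"
      using u v unfolding S_def by blast
    show ?thesis
      unfolding uv comb fS
      by (simp add: E_def matrix_matrix_mult_def vec_eq_iff forall_2 sum_2 field_simps)
  qed
  ultimately show ?thesis
    unfolding iso_to_sl2_def gen using f by blast
qed

end

section \<open>From symmetric Euler elements to orthogonal pairs\<close>

context simple_euclidean
begin

text \<open>For an Euler element \<open>h\<close>, this and \<open>neg_part\<close> are the
  interpolation projections onto degrees 1 and -1. As polynomials in \<open>ad h\<close> they are
  linear for every \<open>h\<close>.\<close>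

definition pos_part :: "'a \<Rightarrow> 'a \<Rightarrow> 'a" where
  "pos_part h y = (1/2) *\<^sub>R (br h (br h y) + br h y)"

definition neg_part :: "'a \<Rightarrow> 'a \<Rightarrow> 'a" where
  "neg_part h y = (1/2) *\<^sub>R (br h (br h y) - br h y)"

lemma linear_pos_part: "linear (pos_part h)"
  by (rule linearI) (simp_all add: pos_part_def br_simps algebra_simps)

lemma linear_neg_part: "linear (neg_part h)"
  by (rule linearI) (simp_all add: neg_part_def br_simps algebra_simps)

lemma pos_part_eig:
  "v \<in> eig br h 1 \<Longrightarrow> pos_part h v = v"
  "v \<in> eig br h 0 \<Longrightarrow> pos_part h v = 0"
  "v \<in> eig br h (-1) \<Longrightarrow> pos_part h v = 0"
  by (simp_all add: pos_part_def eig_def br_simps scaleR_add_right scaleR_half_add_half)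

lemma neg_part_eig:
  "v \<in> eig br h 1 \<Longrightarrow> neg_part h v = 0"
  "v \<in> eig br h 0 \<Longrightarrow> neg_part h v = 0"
  "v \<in> eig br h (-1) \<Longrightarrow> neg_part h v = v"
  by (simp_all add: neg_part_def eig_def br_simps scaleR_add_right scaleR_half_add_half)

lemma euler_parts:
  assumes "euler br h"
  shows "pos_part h v \<in> eig br h 1" "neg_part h v \<in> eig br h (-1)"
    "v - pos_part h v - neg_part h v \<in> eig br h 0"
proof -
  note P = eig_parts[OF euler_cubic[OF assms]]
  show "pos_part h v \<in> eig br h 1" "neg_part h v \<in> eig br h (-1)"
    using P(1,3) by (simp_all add: pos_part_def neg_part_def)
  have "v - pos_part h v - neg_part h v = v - br h (br h v)"
    using sum_parts[of v h] by (simp add: pos_part_def neg_part_def algebra_simps)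
  then show "v - pos_part h v - neg_part h v \<in> eig br h 0" by (simp only: P(2))
qed

lemma subspace_eig: "subspace (eig br h \<mu>)"
  by (simp add: subspace_def eig_def br_simps algebra_simps)

lemma linear_bij_betw:
  fixes f :: "'a \<Rightarrow> 'a"
  assumes "linear f" "subspace S"
    and "\<And>v. v \<in> S \<Longrightarrow> f v = 0 \<Longrightarrow> v = 0"
    and "\<And>w. w \<in> T \<Longrightarrow> \<exists>v\<in>S. f v = w"
    and "\<And>v. f v \<in> T"
  shows "bij_betw f S T"
  unfolding bij_betw_def
proof
  show "inj_on f S"
    using linear_injective_on_subspace_0[OF assms(1,2)] assms(3) by blast
  show "f ` S = T" using assms(4,5) by blast
qed

text \<open>The path from the identity to \<open>\<phi>\<close> consists of automorphisms \<open>g\<close> depending analytically on the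
  parameter, so for generic parameters \<open>g \<gg>\<^sub>1\<close> is at once a graph over \<open>\<gg>\<^sub>1\<close> and a graph over
  \<open>\<gg>\<^sub>-\<^sub>1\<close>, as it is at the respective endpoints.\<close>

lemma generic_automorphism:
  assumes h: "euler br h" and \<phi>: "\<phi> \<in> Inn br" "\<phi> h = - h"
  shows "\<exists>g. lie_aut g
    \<and> bij_betw (\<lambda>v. pos_part h (g v)) (eig br h 1) (eig br h 1)
    \<and> bij_betw (\<lambda>v. neg_part h (g v)) (eig br h 1) (eig br h (-1))
    \<and> (\<exists>u. neg_part h u = 0 \<and> g u - neg_part h (g u) = h)"
proof -
  obtain \<Phi> where \<Phi>: "entire_family \<Phi>" "\<Phi> 0 = id" "\<Phi> 1 = \<phi>" "\<And>t. lie_aut (\<Phi> t)"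
    using Inn_path[OF \<phi>(1)] by blast
  let ?P = "pos_part h" and ?Q = "neg_part h"
  \<comment> \<open>\<open>?R\<close> projects onto degrees 0 and 1. In \<open>?L\<close> the
    inverse of \<open>\<phi>\<close> carries degree -1 back to degree 1, so that the map from degree
    1 to degree -1 becomes an endomorphism with a determinant.\<close>
  let ?R = "\<lambda>v. v - ?Q v" and ?L = "\<lambda>t v. inv \<phi> (?Q (\<Phi> t v))"
  have \<phi>_aut: "lie_aut \<phi>" using \<Phi>(3) \<Phi>(4)[of 1] by simp
  then have \<psi>_aut: "lie_aut (inv \<phi>)" by (rule lie_aut_inv)
  then have \<psi>_lin: "linear (inv \<phi>)" by (simp add: lie_aut_def)
  have \<phi>_bij: "bij \<phi>" using \<phi>_aut by (simp add: lie_aut_def)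
  have "inv \<phi> (- h) = h" using \<phi>(2) \<phi>_bij by (metis bij_inv_eq_iff)
  then have \<psi>h: "inv \<phi> w \<in> eig br h 1" if "w \<in> eig br h (-1)" for w
    using lie_aut_eig[OF \<psi>_aut, of w "- h" 1] that by (simp add: eig_minus)
  have lin: "linear (\<Phi> t)" for t using \<Phi>(4) by (simp add: lie_aut_def)
  have linR: "linear ?R"
    by (intro linear_compose_sub linear_id[unfolded id_def] linear_neg_part)
  note P = euler_parts(1)[OF h] and Q = euler_parts(2)[OF h]
  have idemP: "?P (?P v) = ?P v" for v using P pos_part_eig(1) by blast
  have idemR: "?R (?R v) = ?R v" for v
    using neg_part_eig(3)[OF Q[of v]] by (simp add: linear_diff[OF linear_neg_part])
  have entL: "entire_family ?L"
    using entire_family_compose[OF entire_family_const[OF \<psi>_lin]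
        entire_family_compose[OF entire_family_const[OF linear_neg_part] \<Phi>(1)]] .
  then have linL: "linear (?L t)" for t by (simp add: entire_family_def)
  have id: "inj (corner P id)" if "\<And>v. P (P v) = P v" for P :: "'a \<Rightarrow> 'a"
    using that by (intro injI) (simp add: corner_def)
  have 1: "eventually (\<lambda>t. inj (corner ?P (\<Phi> t))) (at 0)"
    by (rule entire_family_eventually_inj[of _ 0, OF entire_family_corner[OF linear_pos_part \<Phi>(1)]])
       (simp add: \<Phi>(2) id idemP)
  have 2: "eventually (\<lambda>t. inj (corner ?R (\<Phi> t))) (at 0)"
    by (rule entire_family_eventually_inj[of _ 0, OF entire_family_corner[OF linR \<Phi>(1)]])
       (simp only: \<Phi>(2), rule id[of ?R], rule idemR)
  \<comment> \<open>At the endpoint \<open>t = 1\<close>, \<open>\<phi> h = - h\<close> makes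
    \<open>\<phi>\<close> send degree 1 into degree -1, so \<open>?L 1\<close> fixes degree 1
    pointwise.\<close>
  have "corner ?P (?L 1) v = v" for v
  proof -
    have "\<phi> (?P v) \<in> eig br h (-1)"
      using lie_aut_eig[OF \<phi>_aut P] by (simp add: \<phi>(2) eig_minus)
    then have "?L 1 (?P v) = ?P v"
      by (simp add: \<Phi>(3) neg_part_eig(3) bij_is_inj[OF \<phi>_bij])
    then show ?thesis by (simp add: corner_def idemP)
  qed
  then have "inj (corner ?P (?L 1))" by (simp add: inj_def)
  then have 3: "eventually (\<lambda>t. inj (corner ?P (?L t))) (at 0)"
    by (rule entire_family_eventually_inj[OF entire_family_corner[OF linear_pos_part entL]])
  \<comment> \<open>The first two conditions hold at parameter 0 and the third at 1; being generic,
    all three hold together at some \<open>t\<close> near 0.\<close>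
  have "eventually (\<lambda>t. inj (corner ?P (\<Phi> t)) \<and> inj (corner ?R (\<Phi> t)) \<and> inj (corner ?P (?L t))) (at 0)"
    using 1 2 3 by (simp add: eventually_conj_iff)
  then obtain t where t: "inj (corner ?P (\<Phi> t))" "inj (corner ?R (\<Phi> t))" "inj (corner ?P (?L t))"
    using eventually_happens'[OF at_neq_bot] by blast
  have PL: "?P (?L t v) = ?L t v" for v
    by (rule pos_part_eig(1)[OF \<psi>h[OF Q]])
  have pos: "bij_betw (\<lambda>v. ?P (\<Phi> t v)) (eig br h 1) (eig br h 1)"
  proof (rule linear_bij_betw[OF _ subspace_eig])
    show "linear (\<lambda>v. ?P (\<Phi> t v))"
      using linear_compose[OF lin linear_pos_part] by (simp add: o_def)
    show "v = 0" if "v \<in> eig br h 1" "?P (\<Phi> t v) = 0" for v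
      using corner_inj[OF linear_pos_part lin t(1)] pos_part_eig(1) that by blast
    show "\<exists>v\<in>eig br h 1. ?P (\<Phi> t v) = w" if "w \<in> eig br h 1" for w
      using corner_surj[OF linear_pos_part lin t(1) idemP pos_part_eig(1)[OF that]] P by metis
  qed (rule P)
  have neg: "bij_betw (\<lambda>v. ?Q (\<Phi> t v)) (eig br h 1) (eig br h (-1))"
  proof (rule linear_bij_betw[OF _ subspace_eig])
    show "linear (\<lambda>v. ?Q (\<Phi> t v))"
      using linear_compose[OF lin linear_neg_part] by (simp add: o_def)
    show "v = 0" if v: "v \<in> eig br h 1" "?Q (\<Phi> t v) = 0" for v
    proof (rule corner_inj[OF linear_pos_part linL t(3) pos_part_eig(1)[OF v(1)]])
      show "?P (?L t v) = 0"
        unfolding PL using v(2) by (simp add: linear_0[OF \<psi>_lin])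
    qed
    show "\<exists>v\<in>eig br h 1. ?Q (\<Phi> t v) = w" if w: "w \<in> eig br h (-1)" for w
    proof -
      obtain v where v: "?P v = v" "?P (?L t v) = inv \<phi> w"
        using corner_surj[OF linear_pos_part linL t(3) idemP pos_part_eig(1)[OF \<psi>h[OF w]]] by metis
      have "?Q (\<Phi> t v) = w"
        using v(2) unfolding PL by (metis \<phi>_bij bij_inv_eq_iff)
      then show ?thesis using v(1) P by metis
    qed
  qed (rule Q)
  have "h \<in> eig br h 0" by (simp add: eig_def br_self)
  then have "?R h = h" by (simp add: neg_part_eig(2))
  then obtain u where "?R u = u" "?R (\<Phi> t u) = h"
    using corner_surj[OF linR lin t(2) idemR] by metis
  then have "\<exists>u. ?Q u = 0 \<and> \<Phi> t u - ?Q (\<Phi> t u) = h" by auto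
  with \<Phi>(4) pos neg show ?thesis by blast
qed

lemma eig_top:
  assumes h: "euler br h" and "u \<in> eig br h 1" "v \<in> eig br h 1"
  shows "br u v = 0"
  using eig_br[OF assms(2,3)] euler_eig_zero[OF h, of _ 2] by simp

lemma eig_bot:
  assumes h: "euler br h" and "u \<in> eig br h (-1)" "v \<in> eig br h (-1)"
  shows "br u v = 0"
  using eig_br[OF assms(2,3)] euler_eig_zero[OF h, of _ "-2"] by simp

text \<open>Choose \<open>f \<in> \<gg>\<^sub>-\<^sub>1\<close> such that \<open>u = h + f\<close> lies in the parabolic subalgebra \<open>g (\<gg>\<^sub>0 + \<gg>\<^sub>1)\<close>. Then \<open>ad u\<close> is
  the identity on \<open>g \<gg>\<^sub>1\<close>, which exhibits \<open>g \<gg>\<^sub>1\<close> as \<open>exp (ad f) \<gg>\<^sub>1\<close>: its elements have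
  negative part \<open>(ad f)\<^sup>2 / 2\<close> of their positive part.\<close>

lemma symmetric_imp_regular:
  assumes h: "euler br h" and \<phi>: "\<phi> \<in> Inn br" "\<phi> h = - h"
  shows "\<exists>f\<in>eig br h (-1). bij_betw (\<lambda>v. br f (br f v)) (eig br h 1) (eig br h (-1))"
proof -
  obtain g where g: "lie_aut g"
    and pos: "bij_betw (\<lambda>v. pos_part h (g v)) (eig br h 1) (eig br h 1)"
    and neg: "bij_betw (\<lambda>v. neg_part h (g v)) (eig br h 1) (eig br h (-1))"
    and "\<exists>u. neg_part h u = 0 \<and> g u - neg_part h (g u) = h"
    using generic_automorphism[OF h \<phi>] by blast
  then obtain u0 where u0: "neg_part h u0 = 0" "g u0 - neg_part h (g u0) = h" by blast
  define f where "f = neg_part h (g u0)"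
  have f: "f \<in> eig br h (-1)" unfolding f_def by (rule euler_parts(2)[OF h])
  have gu: "g u0 = h + f" using u0(2) by (simp add: f_def algebra_simps)
  have lin: "linear g" and hom: "\<And>a b. g (br a b) = br (g a) (g b)"
    using g by (auto simp: lie_aut_def)
  have key: "br f (br f (pos_part h (g v))) = 2 *\<^sub>R neg_part h (g v)" if v: "v \<in> eig br h 1" for v
  proof -
    define n where "n = g v"
    define a where "a = pos_part h n"
    define c where "c = neg_part h n"
    define b where "b = n - a - c"
    have a: "a \<in> eig br h 1" and b: "b \<in> eig br h 0" and c: "c \<in> eig br h (-1)"
      unfolding a_def b_def c_def using euler_parts[OF h] by simp_all
    have n: "n = a + b + c" by (simp add: b_def)
    \<comment> \<open>\<open>u0\<close> has no component in degree -1, so \<open>ad u0\<close>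
      preserves degree 1.\<close>
    have "br u0 v = br (pos_part h u0) v + br (u0 - pos_part h u0) v"
      by (simp add: br_simps)
    also have "\<dots> \<in> eig br h 1"
      using eig_top[OF h euler_parts(1)[OF h] v] eig_br[OF euler_parts(3)[OF h] v, of u0] u0(1) by simp
    finally have "br u0 v - v \<in> eig br h 1" by (rule subspace_diff[OF subspace_eig _ v])
    moreover have gn: "g (br u0 v - v) = (br f a - b) + (br f b - 2 *\<^sub>R c)"
      using a b c eig_bot[OF h f c]
      by (simp add: linear_diff[OF lin] hom gu n_def[symmetric] n br_simps eig_def scaleR_2)
    have fab: "br f a - b \<in> eig br h 0" "br f b - 2 *\<^sub>R c \<in> eig br h (-1)"
      using eig_br[OF f a] eig_br[OF f b] b c
      by (auto intro!: subspace_diff[OF subspace_eig] subspace_scale[OF subspace_eig])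
    \<comment> \<open>The degree 1 terms \<open>[h, a]\<close> and \<open>a\<close> have cancelled.
      As \<open>pos_part h\<close> after \<open>g\<close> is injective on degree 1,
      \<open>br u0 v = v\<close>, and the remaining degrees give \<open>b = [f, a]\<close> and
      \<open>2 c = [f, b]\<close>.\<close>
    then have "pos_part h (g (br u0 v - v)) = 0"
      unfolding gn by (simp add: linear_add[OF linear_pos_part] pos_part_eig)
    moreover have "pos_part h (g 0) = 0"
      by (simp add: linear_0[OF lin] linear_0[OF linear_pos_part])
    ultimately have "br u0 v - v = 0"
      using inj_onD[OF bij_betw_imp_inj_on[OF pos], of "br u0 v - v" 0] subspace_0[OF subspace_eig] by simp
    then have "0 + (br f a - b) + (br f b - 2 *\<^sub>R c) = 0"
      using gn by (simp add: linear_0[OF lin])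
    moreover have "0 \<in> eig br h 1" by (rule subspace_0[OF subspace_eig])
    ultimately have "br f a - b = 0" "br f b - 2 *\<^sub>R c = 0"
      using eig_sum_zero[OF _ fab] by blast+
    then show ?thesis by (simp add: a_def c_def n_def)
  qed
  have "bij_betw ((\<lambda>v. br f (br f v)) \<circ> (\<lambda>v. pos_part h (g v))) (eig br h 1) (eig br h (-1))"
  proof -
    have "bij_betw (\<lambda>w. 2 *\<^sub>R w) (eig br h (-1)) (eig br h (-1))"
      by (rule bij_betw_byWitness[where f' = "\<lambda>w. (1/2) *\<^sub>R w"])
         (auto intro: subspace_scale[OF subspace_eig])
    from bij_betw_trans[OF neg this] show ?thesis
      by (rule bij_betw_cong[THEN iffD1, rotated]) (simp add: key)
  qed
  then have "bij_betw (\<lambda>v. br f (br f v)) (eig br h 1) (eig br h (-1))"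
    using bij_betw_comp_iff[OF pos] by blast
  then show ?thesis using f by blast
qed

text \<open>\<open>d\<close> measures the failure of \<open>(y, 2h, f)\<close> to be an \<open>\<ss>\<ll>\<^sub>2\<close>-triple. It vanishes because every
  \<open>v \<in> \<gg>\<^sub>1\<close> is a highest weight vector with \<open>f\<^sup>2 v \<noteq> 0 = f\<^sup>3 v\<close>, hence of weight 2.\<close>

lemma regular_imp_triple:
  assumes h: "euler br h" and f: "f \<in> eig br h (-1)"
    and bij: "bij_betw (\<lambda>v. br f (br f v)) (eig br h 1) (eig br h (-1))"
  shows "\<exists>y\<in>eig br h 1. br y f = 2 *\<^sub>R h"
proof -
  have finj: "v = 0" if "v \<in> eig br h 1" "br f (br f v) = 0" for v
    using inj_onD[OF bij_betw_imp_inj_on[OF bij], of v 0] that subspace_0[OF subspace_eig]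
    by (simp add: br_simps)
  have fsurj: "\<exists>v\<in>eig br h 1. br f (br f v) = w" if "w \<in> eig br h (-1)" for w
    using that unfolding bij_betw_imp_surj_on[OF bij, symmetric] by blast
  \<comment> \<open>The factor -2 is forced: \<open>[y, f] = 2 h\<close> would give
    \<open>[f, [f, y]] = 2 [h, f] = -2 f\<close>.\<close>
  obtain y where y: "y \<in> eig br h 1" "br f (br f y) = (-2) *\<^sub>R f"
    using fsurj[OF subspace_scale[OF subspace_eig f]] by blast
  define d where "d = br y f - 2 *\<^sub>R h"
  have yf: "br y f = d + 2 *\<^sub>R h" by (simp add: d_def)
  have "h \<in> eig br h 0" by (simp add: eig_def br_self)
  then have d: "d \<in> eig br h 0"
    unfolding d_def using eig_br[OF y(1) f]
    by (auto intro!: subspace_diff[OF subspace_eig] subspace_scale[OF subspace_eig])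
  have stay: "br d v \<in> eig br h \<mu>" if "v \<in> eig br h \<mu>" for v \<mu>
    using eig_br[OF d that] by simp
  have "br (br y f) f = (-2) *\<^sub>R f"
    using y(2) br_anti[of "br y f" f] br_anti[of y f] by (simp add: br_simps)
  then have df: "br d f = 0" using f by (simp add: d_def br_simps eig_def)
  then have com: "br d (br f v) = br f (br d v)" for v
    using jacobi[of d f v] by (simp add: br_simps)
  have "br f (br f (br d y)) = 0"
    using com[of "br f y"] com[of y] y(2) df by (simp add: br_simps)
  then have dy: "br d y = 0" by (rule finj[OF stay[OF y(1)]])
  have d1: "br d v = 0" if v: "v \<in> eig br h 1" for v
  proof -
    have hf: "br h v = v" "br h (br f v) = 0" "br h (br f (br f v)) = - br f (br f v)"
      using v eig_br[OF f v] eig_br[OF f eig_br[OF f v]] by (simp_all add: eig_def)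
    have step: "br y (br f w) = br d w + 2 *\<^sub>R br h w + br f (br y w)" for w
      using jacobi[of y f w] by (simp add: yf br_simps)
    have "br f (br f (br f v)) = 0"
      using eig_bot[OF h f] eig_br[OF f eig_br[OF f v]] by simp
    then have "0 = br y (br f (br f (br f v)))" by (simp add: br_simps)
    \<comment> \<open>Moving \<open>y\<close> past the three copies of \<open>f\<close> yields three
      equal \<open>d\<close>-terms, while the \<open>h\<close>-terms, of weights 1, 0, -1,
      cancel.\<close>
    also have "\<dots> = 3 *\<^sub>R br f (br f (br d v))"
      using eig_top[OF h y(1) v] scaleR_add_left[of 1 2 "br f (br f (br d v))"]
      by (simp add: step hf com br_simps scaleR_2)
    finally show ?thesis using finj[OF stay[OF v]] by simp
  qed
  have "br d w = 0" if "w \<in> eig br h (-1)" for w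
  proof -
    obtain v where v: "v \<in> eig br h 1" "br f (br f v) = w" using fsurj \<open>w \<in> _\<close> by blast
    then have "br d w = br f (br f (br d v))" using com by metis
    then show ?thesis using d1[OF v(1)] by (simp add: br_simps)
  qed
  with d1 have "d = 0" by (rule centralizer_eig_trivial[OF h])
  then show ?thesis using y(1) yf by auto
qed

lemma symmetric_imp_orthogonal:
  assumes "symmetric_euler br h"
  obtains x where "euler br x" "br h (br h x) = x"
proof -
  obtain \<phi> where h: "euler br h" and \<phi>: "\<phi> \<in> Inn br" "\<phi> h = - h"
    using assms unfolding symmetric_euler_def by blast
  obtain f where f: "f \<in> eig br h (-1)"
    "bij_betw (\<lambda>v. br f (br f v)) (eig br h 1) (eig br h (-1))"
    using symmetric_imp_regular[OF h \<phi>] by blast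
  obtain y where y: "y \<in> eig br h 1" "br y f = 2 *\<^sub>R h"
    using regular_imp_triple[OF h f] by blast
  \<comment> \<open>With these halves \<open>ad h\<close> swaps \<open>x\<close> and
    \<open>z\<close>, and \<open>ad z\<close> rotates the plane of \<open>h\<close> and
    \<open>x\<close>.\<close>
  define x where "x = (1/2) *\<^sub>R (y + f)"
  define z where "z = (1/2) *\<^sub>R (y - f)"
  have hx: "br h x = z" and hz: "br h z = x"
    using y(1) f(1) by (simp_all add: x_def z_def br_simps eig_def)
  have "br z x = h"
    using y(2) br_anti[of f y]
    by (simp add: x_def z_def br_simps br_self)
  moreover have "br z h = - x" using br_anti[of z h] hz by simp
  ultimately have "euler br x" by (intro rotation_euler[OF _ _ h])
  then show ?thesis using that hx hz by simp
qed

section \<open>Assembling both directions\<close>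

lemma orthogonal_pair_iff:
  "orthogonal_pair br h x \<longleftrightarrow> euler br h \<and> euler br x \<and> br h (br h x) = x"
  using sigma_neg_iff by (auto simp: orthogonal_pair_def)

text \<open>Everything follows from the bracket relations of \<open>h\<close>, \<open>x\<close> and
  \<open>z = [h, x]\<close>: rotation by \<open>z\<close> reverses \<open>h\<close>, and rotation by
  \<open>- z\<close> reverses \<open>x\<close>.\<close>

lemma orthogonal_consequences:
  assumes "orthogonal_pair br h x"
  shows "symmetric_euler br h" "symmetric_euler br x"
    "iso_to_sl2 br (gen_subalgebra br {h, x})" "orthogonal_pair br x h"
proof -
  have h: "euler br h" and x: "euler br x" and hhx: "br h (br h x) = x"
    using assms by (simp_all add: orthogonal_pair_iff)
  have xxh: "br x (br x h) = h" by (rule orthogonal_sym[OF h x hhx])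
  define z where "z = br h x"
  have hz: "br h z = x" using hhx by (simp add: z_def)
  have "br x h = - z" unfolding z_def by (rule br_anti)
  then have xz: "br x z = - h" using xxh by (simp add: br_simps minus_equation_iff[of _ h])
  have zh: "br z h = - x" and zx: "br z x = h"
    using hz xz br_anti[of z h] br_anti[of z x] by simp_all
  show "symmetric_euler br h" by (rule rotation_symmetric[OF zh zx h])
  show "symmetric_euler br x"
    by (rule rotation_symmetric[of "- z" x h, OF _ _ x]) (simp_all add: br_simps zh zx)
  show "iso_to_sl2 br (gen_subalgebra br {h, x})"
    using h by (intro gen_subalgebra_sl2[OF _ z_def[symmetric] hz xz]) (simp add: euler_def)
  show "orthogonal_pair br x h" using h x xxh by (simp add: orthogonal_pair_iff)
qed

end

theorem theorem3p13:
  fixes br :: "'a::euclidean_space \<Rightarrow> 'a \<Rightarrow> 'a" and h :: 'a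
  assumes "simple_lie br" and "euler br h"
  shows "(\<forall>x. euler br x \<and> orthogonal_pair br h x \<longrightarrow>
            symmetric_euler br h \<and> symmetric_euler br x \<and>
            iso_to_sl2 br (gen_subalgebra br {h, x}) \<and>
            sigma br x h = - h \<and> orthogonal_pair br x h)
       \<and> ((\<exists>x. euler br x \<and> orthogonal_pair br h x) \<longleftrightarrow> symmetric_euler br h)"
proof -
  interpret simple_euclidean br
    using assms(1) by unfold_locales (simp_all add: simple_lie_def)
  have "sigma br x h = - h" if "orthogonal_pair br x h" for x
    using that by (simp add: orthogonal_pair_def)
  moreover have "\<exists>x. euler br x \<and> orthogonal_pair br h x" if "symmetric_euler br h"
    using symmetric_imp_orthogonal[OF that] assms(2) by (metis orthogonal_pair_iff)
  ultimately show ?thesis using orthogonal_consequences by blast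
qed

end
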